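(* Let $n\ge 2$ be an integer and let $\eta=\eta_1+i\eta_2$ (with $\eta_1,\eta_2$ real-valued) be the Lévy symbol of a one-dimensional Lévy process $X_t$, with $\eta\in C^2(\mathbb R\setminus\{0\})$. Suppose there are $0<\epsilon\le 1$, $\alpha_\epsilon>0$ and a constant $c>0$ such that for all $\xi\in\mathbb R$ ($\xi\neq 0$ where derivatives or negative powers of $|\xi|$ are involved): $$\eta_1(\xi)\ \ge\ \alpha_\epsilon\, s_n^{\epsilon}(\xi),$$ $$|\eta_2(\xi)|\ \le\ c\begin{cases}|\xi|^{\epsilon}, & |\xi|\le 1,\\ s_n^{\epsilon-1}(\xi)\, r_{n-1}^{-1}(\xi), & |\xi|\ge 1,\end{cases}$$ $$|\eta_1'(\xi)|,\ |\eta_2'(\xi)|\ \le\ c\begin{cases}|\xi|^{\epsilon-1}, & |\xi|\le 1,\\ s_n^{\epsilon-1}(\xi)\, r_{n-1}^{-1}(\xi)\,(1+|\xi|)^{-1}, & |\xi|\ge 1,\end{cases}$$ $$|\eta_1''(\xi)|,\ |\eta_2''(\xi)|\ \le\ c\begin{cases}|\xi|^{\epsilon-2}, & |\xi|\le 1,\\ s_n^{\epsilon-1}(\xi)\, r_{n-1}^{-1}(\xi)\,(1+|\xi|)^{-2}, & |\xi|\ge 1.\end{cases}$$ Then $X_t$ has a transition density $p_t$ such that for all $0<t<\infty$: if $0<|x|\le 1$, then $$p_t(x)\ \le\ c(t)\,\frac1{|x|}\,e^{-\alpha_\epsilon t\, s_n^{\epsilon}(\frac1x)}\, s_n^{\epsilon-1}\big(\tfrac1x\big)\,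 r_{n-1}^{-1}\big(\tfrac1x\big),$$ and if $|x|\ge 1$, then $$p_t(x)\ \le\ c(t)\begin{cases}|x|^{-1-\epsilon}, & 0<\epsilon<1,\\ |x|^{-2}\ln(1+|x|), & \epsilon=1,\end{cases}$$ where $c(t)$ is a positive constant depending on $t$ (not on $x$) such that $c(t)\le c\,t$ for $t\le 1$, for some constant $c>0$. Moreover, if $|\eta_1''|$ is integrable on the interval $(0,1)$ and $\epsilon=1$, then for $|x|\ge 1$ $$p_t(x)\ \le\ c(t)\,|x|^{-2}.$$
   Context: The Lévy symbol $\eta$ of a one-dimensional Lévy process $X_t$ with distributions $P_t$ is defined by $\int_{\mathbb R}e^{i\xi y}P_t(dy)=e^{-t\eta(\xi)}$; it has the form $\eta(\xi)=-ib\xi+\frac12A\xi^2-\int_{\mathbb R}\big(e^{i\xi y}-1-i\xi y\,I_{(-1,1)}(y)\big)\nu(dy)$ with $b\in\mathbb R$, $A\ge 0$ and a Lévy measure $\nu$ satisfying $\int_{\mathbb R}\min(1,|y|^2)\,\nu(dy)<\infty$. A transition density of $X_t$ is a family $p_t$, $t>0$, with $P_t(dx)=p_t(x)\,dx$. Notation: $s_1(\xi)=\ln(1+|\xi|)$, $s_n(\xi)=\ln(1+s_{n-1}(\xi))$ for $n\ge 2$, and $r_n(\xi)=s_n(\xi)s_{n-1}(\xi)\cdots s_1(\xi)$. Powers are of values: $s_n^{a}(\xi)=(s_n(\xi))^a$, $r_{n-1}^{-1}(\xi)=1/r_{n-1}(\xi)$. *)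

theory Defs
  imports "HOL-Probability.Probability"
begin

text \<open>
  A real-valued Levy process with time set \<open>[0, \<infinity>)\<close>; the values \<open>X t\<close> for \<open>t < 0\<close> are irrelevant.
  Only stochastic continuity is required, not cadlag paths: a cadlag version always exists, and
  the notions below depend on the one-dimensional distributions only.
\<close>

locale levy_process = prob_space M for M :: "'w measure" +
  fixes X :: "real \<Rightarrow> 'w \<Rightarrow> real"
  assumes random_variable_X: "\<And>t. 0 \<le> t \<Longrightarrow> X t \<in> borel_measurable M"
    and start_zero: "AE \<omega> in M. X 0 \<omega> = 0"
    and independent_increments:
      "\<And>(\<tau> :: nat \<Rightarrow> real) m. 0 \<le> \<tau> 0 \<Longrightarrow> strict_mono \<tau> \<Longrightarrow>
         indep_vars (\<lambda>_. borel) (\<lambda>i \<omega>. X (\<tau> (Suc i)) \<omega> - X (\<tau> i) \<omega>) {..<m}"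
    and stationary_increments:
      "\<And>s t. 0 \<le> s \<Longrightarrow> 0 \<le> t \<Longrightarrow> distr M borel (\<lambda>\<omega>. X (s + t) \<omega> - X s \<omega>) = distr M borel (X t)"
    and stochastic_continuity:
      "\<And>t \<delta>. 0 \<le> t \<Longrightarrow> 0 < \<delta> \<Longrightarrow>
         ((\<lambda>s. prob {\<omega> \<in> space M. \<delta> < \<bar>X s \<omega> - X t \<omega>\<bar>}) \<longlongrightarrow> 0) (at t within {0..})"

text \<open>
  Requiring the identity for all \<open>t\<close> determines \<open>\<eta>\<close> uniquely (a single \<open>t\<close> would leave the imaginary
  part ambiguous modulo \<open>2 \<pi> / t\<close>). The Levy-Khintchine representation of \<open>\<eta>\<close> is then a theorem and
  is not part of the definition.
\<close>

definition levy_symbol :: "'w measure \<Rightarrow> (real \<Rightarrow> 'w \<Rightarrow> real) \<Rightarrow> (real \<Rightarrow> complex) \<Rightarrow> bool" where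
  "levy_symbol M X \<eta> \<longleftrightarrow>
     (\<forall>t\<ge>0. \<forall>\<xi>. char (distr M borel (X t)) \<xi> = exp (- (of_real t * \<eta> \<xi>)))"

definition transition_density :: "'w measure \<Rightarrow> (real \<Rightarrow> 'w \<Rightarrow> real) \<Rightarrow> (real \<Rightarrow> real \<Rightarrow> real) \<Rightarrow> bool" where
  "transition_density M X p \<longleftrightarrow>
     (\<forall>t>0. (\<forall>x. 0 \<le> p t x) \<and> distributed M lborel (X t) (\<lambda>x. ennreal (p t x)))"

definition C2_differentiable_on :: "(real \<Rightarrow> 'a::real_normed_vector) \<Rightarrow> real set \<Rightarrow> bool"
    (infix \<open>C2'_differentiable'_on\<close> 50) where
  "f C2_differentiable_on S \<longleftrightarrow>
     f C1_differentiable_on S \<and> (\<lambda>x. vector_derivative f (at x)) C1_differentiable_on S"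

text \<open>The index starts at 0 with the convention \<open>s\<^sub>0(\<xi>) = \<bar>\<xi>\<bar>\<close>, so that \<open>s\<^sub>1(\<xi>) = ln (1 + \<bar>\<xi>\<bar>)\<close>.\<close>

fun slog :: "nat \<Rightarrow> real \<Rightarrow> real" where
  "slog 0 \<xi> = \<bar>\<xi>\<bar>"
| "slog (Suc n) \<xi> = ln (1 + slog n \<xi>)"

definition rlog :: "nat \<Rightarrow> real \<Rightarrow> real" where
  "rlog n \<xi> = (\<Prod>k = 1..n. slog k \<xi>)"

end

theory Submission
  imports Defs
begin

text \<open>
  Let \<open>\<phi>\<close> be the characteristic function of \<open>X t\<close> and \<open>u = Re \<phi> = exp (- t \<eta>1) cos (t \<eta>2)\<close>.
  A density is nonnegative, so \<open>p x \<le> p x + p (- x)\<close>, and Fourier inversion expresses the right-hand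
  side by the cosine transform \<open>(2 / \<pi>) \<integral>\<^sub>0\<^sup>\<infinity> cos (x \<xi>) u(\<xi>) d\<xi>\<close> alone: the contribution of \<open>Im \<phi>\<close>
  is odd in \<open>x\<close> and cancels. This is what makes the last claim true although only \<open>\<eta>1''\<close> is assumed
  integrable near 0: in \<open>u''\<close> the derivative \<open>\<eta>2''\<close> carries the small factor \<open>sin (t \<eta>2)\<close>.

  The cosine transform is estimated for \<open>x > 0\<close> by splitting at \<open>R = 1/x\<close>
  (\<open>oscillatory_integral_bound\<close>). After one integration by parts the part below \<open>R\<close> is controlled by
  \<open>\<bar>sin (x \<xi>)\<bar> \<le> x \<xi>\<close>; the part above \<open>R\<close> is integrated by parts a second time. What is left
  are \<open>\<integral>\<^sub>0\<^sup>R \<xi> \<bar>u'(\<xi>)\<bar> d\<xi>\<close> and \<open>R\<^sup>2 \<integral>\<^sub>R\<^sup>\<infinity> \<bar>u''(\<xi>)\<bar> d\<xi>\<close>. For \<open>R \<ge> 1\<close> both are at most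
  a constant multiple of \<open>t R W(R)\<close>, where \<open>W = exp (- \<alpha> t s\<^sub>n\<^bsup>\<epsilon>\<^esup>) s\<^sub>n\<^bsup>\<epsilon>-1\<^esup> / r\<^sub>n\<^sub>-\<^sub>1\<close>: the second because
  \<open>W\<close> is decreasing, the first because \<open>W\<close> varies slowly (\<open>damped_weight_slowly_varying\<close>). For
  \<open>R \<le> 1\<close> the bounds by powers of \<open>\<xi>\<close> are integrated directly.

  The function \<open>\<phi>\<close> is in general not integrable, since \<open>\<bar>\<phi>\<bar>\<close> may decay as slowly as an iterated
  logarithm. The bounds are therefore proved for the integrals over \<open>[0, T]\<close>, up to an error tending to 0 as
  \<open>T \<rightarrow> \<infinity>\<close>. Levy's inversion theorem then bounds the probability of every interval \<open>(c, d]\<close> with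
  \<open>c > 0\<close> by the integral of the claimed envelope (\<open>measure_Ioc_le_of_cosine_transform\<close>); the
  distribution has no atoms because \<open>\<phi>\<close> vanishes at infinity. A measure that is dominated on half-open
  intervals is dominated on all Borel sets, so that the Radon-Nikodym theorem yields a density
  below the envelope (\<open>density_of_cosine_transform_bound\<close>).
\<close>

section \<open>Iterated logarithms and their slow variation\<close>

lemma slog_nonneg: "0 \<le> slog n \<xi>"
  by (induction n) auto

lemma slog_pos: "\<xi> \<noteq> 0 \<Longrightarrow> 0 < slog n \<xi>"
  by (induction n) auto

lemma slog_abs: "slog n \<bar>\<xi>\<bar> = slog n \<xi>"
  by (induction n) auto

lemma rlog_abs: "rlog n \<bar>\<xi>\<bar> = rlog n \<xi>"
  by (simp add: rlog_def slog_abs)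

lemma slog_mono: "\<bar>\<xi>\<bar> \<le> \<bar>\<zeta>\<bar> \<Longrightarrow> slog n \<xi> \<le> slog n \<zeta>"
proof (induction n)
  case (Suc n)
  then show ?case using slog_nonneg[of n \<xi>] slog_nonneg[of n \<zeta>] by simp
qed simp

lemma slog_at_top: "filterlim (slog n) at_top at_top"
proof (induction n)
  case 0
  have "filterlim (\<lambda>\<xi>::real. \<bar>\<xi>\<bar>) at_top at_top" by (rule filterlim_abs_real)
  moreover have "slog 0 = (\<lambda>\<xi>. \<bar>\<xi>\<bar>)" by auto
  ultimately show ?case by simp
next
  case (Suc n)
  have "filterlim (\<lambda>\<xi>. ln (1 + slog n \<xi>)) at_top at_top"
    by (rule filterlim_compose[OF ln_at_top])
       (rule filterlim_tendsto_add_at_top[OF tendsto_const Suc])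
  moreover have "slog (Suc n) = (\<lambda>\<xi>. ln (1 + slog n \<xi>))" by auto
  ultimately show ?case by simp
qed

lemma continuous_on_slog: "continuous_on S (slog n)"
proof (induction n)
  case 0
  have "slog 0 = (\<lambda>\<xi>. \<bar>\<xi>\<bar>)" by auto
  then show ?case by (simp add: continuous_on_rabs)
next
  case (Suc n)
  have "continuous_on S (\<lambda>\<xi>. ln (1 + slog n \<xi>))"
    using Suc by (intro continuous_intros) (use slog_nonneg[of n] in \<open>auto simp: add_nonneg_eq_0_iff\<close>)
  moreover have "slog (Suc n) = (\<lambda>\<xi>. ln (1 + slog n \<xi>))" by auto
  ultimately show ?case by simp
qed

lemma rlog_pos: "\<xi> \<noteq> 0 \<Longrightarrow> 0 < rlog n \<xi>"
  unfolding rlog_def by (intro prod_pos slog_pos ballI)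

lemma rlog_mono: "\<bar>\<xi>\<bar> \<le> \<bar>\<zeta>\<bar> \<Longrightarrow> rlog n \<xi> \<le> rlog n \<zeta>"
  unfolding rlog_def by (intro prod_mono conjI slog_nonneg slog_mono)

lemma continuous_on_rlog: "continuous_on S (rlog n)"
proof -
  have "continuous_on S (\<lambda>\<xi>. \<Prod>k = 1..n. slog k \<xi>)"
    by (intro continuous_on_prod continuous_on_slog)
  moreover have "rlog n = (\<lambda>\<xi>. \<Prod>k = 1..n. slog k \<xi>)" by (auto simp: rlog_def)
  ultimately show ?thesis by simp
qed

text \<open>The function \<open>s\<^sub>n\<^bsup>\<epsilon>-1\<^esup> / r\<^sub>n\<^sub>-\<^sub>1\<close>. Up to the factor \<open>\<epsilon>\<close> it is asymptotically the derivative of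
  \<open>s\<^sub>n\<^bsup>\<epsilon>\<^esup>\<close> with respect to \<open>ln \<xi>\<close>.\<close>

definition log_weight :: "nat \<Rightarrow> real \<Rightarrow> real \<Rightarrow> real" where
  "log_weight n \<epsilon> \<xi> = slog n \<xi> powr (\<epsilon> - 1) / rlog (n - 1) \<xi>"

text \<open>The weight multiplied by the decay factor that the lower bound on \<open>\<eta>1\<close> gives for \<open>\<bar>\<phi>\<bar>\<close>;
  the parameter \<open>a\<close> stands for \<open>\<alpha> t\<close>.\<close>

definition damped_weight :: "nat \<Rightarrow> real \<Rightarrow> real \<Rightarrow> real \<Rightarrow> real" where
  "damped_weight n \<epsilon> a \<xi> = exp (- (a * slog n \<xi> powr \<epsilon>)) * log_weight n \<epsilon> \<xi>"

lemma log_weight_pos: "\<xi> \<noteq> 0 \<Longrightarrow> 0 < log_weight n \<epsilon> \<xi>"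
  using slog_pos[of \<xi> n] rlog_pos[of \<xi> "n - 1"] by (simp add: log_weight_def)

lemma log_weight_antimono:
  assumes "\<epsilon> \<le> 1" "0 < \<xi>" "\<xi> \<le> \<zeta>"
  shows "log_weight n \<epsilon> \<zeta> \<le> log_weight n \<epsilon> \<xi>"
proof -
  have "slog n \<zeta> powr (\<epsilon> - 1) \<le> slog n \<xi> powr (\<epsilon> - 1)"
    using assms slog_pos[of \<xi> n] slog_mono[of \<xi> \<zeta> n] by (intro powr_mono2') auto
  then show ?thesis
    unfolding log_weight_def
    using assms rlog_pos[of \<xi> "n - 1"] rlog_mono[of \<xi> \<zeta> "n - 1"] by (intro frac_le) auto
qed

lemma damped_weight_pos: "\<xi> \<noteq> 0 \<Longrightarrow> 0 < damped_weight n \<epsilon> a \<xi>"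
  using log_weight_pos[of \<xi> n \<epsilon>] by (simp add: damped_weight_def)

lemma damped_weight_antimono:
  assumes "0 < \<epsilon>" "\<epsilon> \<le> 1" "0 \<le> a" "0 < \<xi>" "\<xi> \<le> \<zeta>"
  shows "damped_weight n \<epsilon> a \<zeta> \<le> damped_weight n \<epsilon> a \<xi>"
proof -
  have "slog n \<xi> powr \<epsilon> \<le> slog n \<zeta> powr \<epsilon>"
    using assms by (intro powr_mono2 slog_mono slog_nonneg) auto
  then have "exp (- (a * slog n \<zeta> powr \<epsilon>)) \<le> exp (- (a * slog n \<xi> powr \<epsilon>))"
    using assms by (simp add: mult_left_mono)
  then show ?thesis
    unfolding damped_weight_def using assms log_weight_antimono[of \<epsilon> \<xi> \<zeta> n] log_weight_pos[of \<zeta> n \<epsilon>]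
    by (intro mult_mono) auto
qed

lemma continuous_on_damped_weight: "continuous_on {0<..} (damped_weight n \<epsilon> a)"
proof -
  have pos: "slog n \<xi> \<noteq> 0" "rlog (n - 1) \<xi> \<noteq> 0" if "0 < \<xi>" for \<xi>
    using that slog_pos[of \<xi> n] rlog_pos[of \<xi> "n - 1"] by auto
  have "continuous_on {0<..} (\<lambda>\<xi>. exp (- (a * slog n \<xi> powr \<epsilon>)) * (slog n \<xi> powr (\<epsilon> - 1) / rlog (n - 1) \<xi>))"
    using pos
    by (intro continuous_on_mult continuous_on_exp continuous_on_minus continuous_on_divide
          continuous_on_powr' continuous_on_slog continuous_on_rlog continuous_on_const)
       (auto simp: slog_nonneg)
  then show ?thesis by (simp add: damped_weight_def[abs_def] log_weight_def)
qed

lemma ln_one_plus_mult_le: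
  fixes m s :: real
  assumes "1 \<le> m" "0 \<le> s"
  shows "ln (1 + m * s) \<le> m * ln (1 + s)"
proof -
  let ?f = "\<lambda>s. m * ln (1 + s) - ln (1 + m * s)"
  have "?f 0 \<le> ?f s"
  proof (rule DERIV_nonneg_imp_nondecreasing[OF assms(2)])
    fix x :: real assume x: "0 \<le> x" "x \<le> s"
    have pos: "0 < 1 + x" "0 < 1 + m * x" using x assms by (auto intro: add_pos_nonneg)
    have "(?f has_real_derivative m * (1 / (1 + x)) - m / (1 + m * x)) (at x)"
      using pos by (auto intro!: derivative_eq_intros)
    moreover have "m / (1 + m * x) \<le> m / (1 + x)"
      using x assms pos by (intro divide_left_mono) (auto intro: mult_right_mono[of 1 m x, simplified])
    ultimately show "\<exists>y. (?f has_real_derivative y) (at x) \<and> 0 \<le> y" by fastforce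
  qed
  then show ?thesis by simp
qed

text \<open>Slow variation: one factor, logarithmic in \<open>\<zeta> / \<xi>\<close>, serves for all iterated logarithms.\<close>

lemma slog_slowly_varying:
  assumes "1 \<le> \<xi>" "\<xi> \<le> \<zeta>" "1 \<le> k"
  shows "slog k \<zeta> \<le> (1 + ln (\<zeta> / \<xi>) / ln 2) * slog k \<xi>"
  using \<open>1 \<le> k\<close>
proof (induction k rule: dec_induct)
  case base
  have r: "1 \<le> \<zeta> / \<xi>" using assms by simp
  have "ln (1 + \<zeta>) \<le> ln ((\<zeta> / \<xi>) * (1 + \<xi>))"
    using assms by (subst ln_le_cancel_iff) (auto simp: field_simps add_pos_pos)
  also have "\<dots> = ln (\<zeta> / \<xi>) + ln (1 + \<xi>)"
    using assms by (subst ln_mult_pos) auto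
  also have "ln (\<zeta> / \<xi>) \<le> ln (\<zeta> / \<xi>) / ln 2 * ln (1 + \<xi>)"
  proof -
    have "ln 2 \<le> ln (1 + \<xi>)" using assms by simp
    then have "ln (\<zeta> / \<xi>) * 1 \<le> ln (\<zeta> / \<xi>) * (ln (1 + \<xi>) / ln 2)"
      using r by (intro mult_left_mono) auto
    then show ?thesis by simp
  qed
  finally show ?case using assms by (simp add: algebra_simps)
next
  case (step k)
  define m where "m = 1 + ln (\<zeta> / \<xi>) / ln 2"
  have m: "1 \<le> m" using assms by (simp add: m_def)
  have s: "0 \<le> slog k \<xi>" "0 \<le> slog k \<zeta>" by (rule slog_nonneg)+
  have "ln (1 + slog k \<zeta>) \<le> ln (1 + m * slog k \<xi>)"
    using step.IH m s by (subst ln_le_cancel_iff) (auto simp: m_def intro!: add_pos_nonneg)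
  also have "\<dots> \<le> m * ln (1 + slog k \<xi>)" using m s by (intro ln_one_plus_mult_le)
  finally show ?case by (simp add: m_def)
qed

text \<open>Since \<open>s\<^sub>n = ln (1 + s\<^sub>n\<^sub>-\<^sub>1)\<close> with \<open>n - 1 \<ge> 1\<close>, multiplying \<open>s\<^sub>n\<^sub>-\<^sub>1\<close> by \<open>m\<close> adds only \<open>ln m\<close> to
  \<open>s\<^sub>n\<close>; the subadditivity of \<open>y \<mapsto> y\<^bsup>\<epsilon>\<^esup>\<close> does the rest.\<close>

lemma slog_powr_increment:
  assumes "1 \<le> \<xi>" "\<xi> \<le> \<zeta>" "2 \<le> n" "0 < \<epsilon>" "\<epsilon> \<le> 1"
  shows "slog n \<zeta> powr \<epsilon> \<le> slog n \<xi> powr \<epsilon> + (1 + ln (1 + ln (\<zeta> / \<xi>) / ln 2))"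
proof -
  define m where "m = 1 + ln (\<zeta> / \<xi>) / ln 2"
  have m: "1 \<le> m" using assms by (simp add: m_def)
  obtain k where k: "n = Suc k" "1 \<le> k" using assms(3) by (cases n) auto
  have s: "0 \<le> slog k \<xi>" "0 \<le> slog k \<zeta>" by (rule slog_nonneg)+
  have "1 + slog k \<zeta> \<le> m * (1 + slog k \<xi>)"
    using slog_slowly_varying[OF assms(1,2) k(2)] m by (simp add: m_def[symmetric] algebra_simps)
  then have "ln (1 + slog k \<zeta>) \<le> ln (m * (1 + slog k \<xi>))"
    using m s by (subst ln_le_cancel_iff) (auto intro!: mult_pos_pos add_pos_nonneg)
  also have "\<dots> = ln m + ln (1 + slog k \<xi>)" using m s by (subst ln_mult_pos) auto
  finally have *: "slog n \<zeta> \<le> ln m + slog n \<xi>" by (simp add: k)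
  have lnm: "0 \<le> ln m" using m by simp
  have "slog n \<zeta> powr \<epsilon> \<le> (ln m + slog n \<xi>) powr \<epsilon>"
    using assms * by (intro powr_mono2 slog_nonneg) auto
  also have "\<dots> \<le> ln m powr \<epsilon> + slog n \<xi> powr \<epsilon>"
  proof (cases "ln m + slog n \<xi> = 0")
    case False
    define z where "z = ln m + slog n \<xi>"
    have z: "0 < z" using False lnm slog_nonneg[of n \<xi>] by (simp add: z_def)
    \<comment> \<open>subadditivity, from \<open>y z\<^bsup>\<epsilon>-1\<^esup> \<le> y\<^bsup>\<epsilon>\<^esup>\<close> for \<open>y \<le> z\<close>\<close>
    have sub: "y * z powr (\<epsilon> - 1) \<le> y powr \<epsilon>" if "0 \<le> y" "y \<le> z" for y
    proof (cases "y = 0")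
      case False
      then have "z powr (\<epsilon> - 1) \<le> y powr (\<epsilon> - 1)" using that assms by (intro powr_mono2') auto
      then have "y * z powr (\<epsilon> - 1) \<le> y * y powr (\<epsilon> - 1)" using that by (intro mult_left_mono) auto
      then show ?thesis using that by (simp add: powr_mult_base)
    qed simp
    have "z powr \<epsilon> = z * z powr (\<epsilon> - 1)" using z by (simp add: powr_mult_base)
    also have "\<dots> = ln m * z powr (\<epsilon> - 1) + slog n \<xi> * z powr (\<epsilon> - 1)"
      using z lnm slog_nonneg[of n \<xi>] by (simp add: z_def algebra_simps)
    also have "\<dots> \<le> ln m powr \<epsilon> + slog n \<xi> powr \<epsilon>"
      using lnm slog_nonneg[of n \<xi>] by (intro add_mono sub) (auto simp: z_def)
    finally show ?thesis by (simp add: z_def)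
  qed (use lnm in auto)
  also have "ln m powr \<epsilon> \<le> 1 + ln m"
  proof -
    have "ln m powr \<epsilon> \<le> (1 + ln m) powr \<epsilon>" using lnm assms by (intro powr_mono2) auto
    also have "\<dots> \<le> (1 + ln m) powr 1" using lnm assms by (intro powr_mono) auto
    finally show ?thesis using lnm by simp
  qed
  finally show ?thesis by (simp add: m_def)
qed

lemma log_weight_slowly_varying:
  assumes "1 \<le> \<xi>" "\<xi> \<le> \<zeta>" "2 \<le> n" "0 < \<epsilon>" "\<epsilon> \<le> 1"
  shows "log_weight n \<epsilon> \<xi> \<le> (1 + ln (\<zeta> / \<xi>) / ln 2) ^ n * log_weight n \<epsilon> \<zeta>"
proof -
  define m where "m = 1 + ln (\<zeta> / \<xi>) / ln 2"
  have m: "1 \<le> m" using assms by (simp add: m_def)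
  have pos: "0 < slog k \<xi>" "0 < slog k \<zeta>" for k using assms by (auto intro!: slog_pos)
  have s: "slog k \<zeta> \<le> m * slog k \<xi>" if "1 \<le> k" for k
    using slog_slowly_varying[OF assms(1,2) that] by (simp add: m_def)
  have "rlog (n - 1) \<zeta> \<le> (\<Prod>k = 1..n - 1. m * slog k \<xi>)"
    unfolding rlog_def using s slog_nonneg by (intro prod_mono) auto
  also have "\<dots> = m ^ (n - 1) * rlog (n - 1) \<xi>" by (simp add: prod.distrib rlog_def)
  finally have r: "rlog (n - 1) \<zeta> \<le> m ^ (n - 1) * rlog (n - 1) \<xi>" .
  have "(m * slog n \<xi>) powr (\<epsilon> - 1) \<le> slog n \<zeta> powr (\<epsilon> - 1)"
    using s[of n] pos[of n] assms by (intro powr_mono2') auto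
  then have "m powr (\<epsilon> - 1) * slog n \<xi> powr (\<epsilon> - 1) \<le> slog n \<zeta> powr (\<epsilon> - 1)"
    using m pos[of n] by (simp add: powr_mult)
  moreover have "m powr (- 1) \<le> m powr (\<epsilon> - 1)" using m assms by (intro powr_mono) auto
  ultimately have "m powr (- 1) * slog n \<xi> powr (\<epsilon> - 1) \<le> slog n \<zeta> powr (\<epsilon> - 1)"
    by (meson mult_right_mono order_trans powr_ge_zero)
  then have p: "slog n \<xi> powr (\<epsilon> - 1) \<le> m * slog n \<zeta> powr (\<epsilon> - 1)"
    using m by (simp add: powr_minus field_simps)
  have rp: "0 < rlog (n - 1) \<xi>" "0 < rlog (n - 1) \<zeta>" using assms by (auto intro!: rlog_pos)
  have "1 / rlog (n - 1) \<xi> \<le> m ^ (n - 1) * (1 / rlog (n - 1) \<zeta>)"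
    using r rp by (simp add: field_simps)
  then have "slog n \<xi> powr (\<epsilon> - 1) * (1 / rlog (n - 1) \<xi>)
      \<le> (m * slog n \<zeta> powr (\<epsilon> - 1)) * (m ^ (n - 1) * (1 / rlog (n - 1) \<zeta>))"
    using p rp m by (intro mult_mono) auto
  moreover have "m * m ^ (n - 1) = m ^ n" using assms by (cases n) auto
  ultimately show ?thesis by (simp add: log_weight_def m_def mult_ac)
qed

text \<open>Up to a constant, \<open>\<xi>\<^bsup>1/2\<^esup>\<close> times the damped weight is increasing on \<open>[1, \<infinity>)\<close>. The hypothesis
  \<open>n \<ge> 2\<close> enters here: the damping factor then varies by at most a constant times a power of
  \<open>m = 1 + ln (\<zeta> / \<xi>) / ln 2\<close>, whatever the size of \<open>a\<close>, and every power of \<open>m\<close> is dominated by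
  \<open>(\<zeta> / \<xi>)\<^bsup>1/2\<^esup>\<close>.\<close>

lemma damped_weight_slowly_varying:
  assumes "2 \<le> n" "0 < \<epsilon>" "\<epsilon> \<le> 1" "0 \<le> b"
  obtains K where "0 < K"
    "\<And>a \<xi> \<zeta>. 0 \<le> a \<Longrightarrow> a \<le> b \<Longrightarrow> 1 \<le> \<xi> \<Longrightarrow> \<xi> \<le> \<zeta> \<Longrightarrow>
       damped_weight n \<epsilon> a \<xi> \<le> K * sqrt (\<zeta> / \<xi>) * damped_weight n \<epsilon> a \<zeta>"
proof
  define p where "p = real n + b"
  have p: "0 < p" using assms by (simp add: p_def)
  let ?K = "exp b * (1 + 2 * p / ln 2) powr p"
  show "0 < ?K" using p by (auto intro!: mult_pos_pos simp: add_nonneg_eq_0_iff)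
  fix a \<xi> \<zeta> :: real
  assume a: "0 \<le> a" "a \<le> b" and x: "1 \<le> \<xi>" "\<xi> \<le> \<zeta>"
  define r where "r = \<zeta> / \<xi>"
  define m where "m = 1 + ln r / ln 2"
  have r: "1 \<le> r" using x by (simp add: r_def)
  have m: "1 \<le> m" using r by (simp add: m_def)
  have "a * slog n \<zeta> powr \<epsilon> \<le> a * (slog n \<xi> powr \<epsilon> + (1 + ln m))"
    using slog_powr_increment[OF x assms(1-3)] a by (intro mult_left_mono) (auto simp: m_def r_def)
  also have "\<dots> \<le> a * slog n \<xi> powr \<epsilon> + b * (1 + ln m)"
    using a m by (simp add: distrib_left mult_right_mono add_mono)
  finally have "exp (- (a * slog n \<xi> powr \<epsilon>)) \<le> exp (b * (1 + ln m) + - (a * slog n \<zeta> powr \<epsilon>))"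
    by simp
  also have "\<dots> = exp b * m powr b * exp (- (a * slog n \<zeta> powr \<epsilon>))"
    using m by (simp add: exp_add[symmetric] powr_def algebra_simps)
  finally have e: "exp (- (a * slog n \<xi> powr \<epsilon>)) \<le> exp b * m powr b * exp (- (a * slog n \<zeta> powr \<epsilon>))" .
  have w: "log_weight n \<epsilon> \<xi> \<le> m powr n * log_weight n \<epsilon> \<zeta>"
    using log_weight_slowly_varying[OF x assms(1-3)] m by (simp add: m_def r_def powr_realpow)
  have "damped_weight n \<epsilon> a \<xi> \<le> (exp b * m powr b * exp (- (a * slog n \<zeta> powr \<epsilon>))) * (m powr n * log_weight n \<epsilon> \<zeta>)"
    unfolding damped_weight_def using e w x log_weight_pos[of \<xi> n \<epsilon>] by (intro mult_mono) auto
  also have "\<dots> = exp b * m powr p * damped_weight n \<epsilon> a \<zeta>"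
    by (simp add: damped_weight_def p_def powr_add)
  also have "m powr p \<le> (1 + 2 * p / ln 2) powr p * sqrt r"
  proof -
    define q where "q = r powr (1 / (2 * p))"
    have q: "1 \<le> q" using r p by (simp add: q_def ge_one_powr_ge_zero)
    have "ln r = 2 * p * ln q" using p r by (simp add: q_def ln_powr)
    also have "\<dots> \<le> 2 * p * q" using p q ln_bound[of q] by (intro mult_left_mono) auto
    finally have "m \<le> 1 + 2 * p * q / ln 2" by (simp add: m_def divide_right_mono)
    also have "\<dots> \<le> (1 + 2 * p / ln 2) * q" using q by (simp add: algebra_simps)
    finally have "m powr p \<le> ((1 + 2 * p / ln 2) * q) powr p" using p m by (intro powr_mono2) auto
    also have "\<dots> = (1 + 2 * p / ln 2) powr p * q powr p" using p q by (intro powr_mult)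
    also have "q powr p = sqrt r" using p r by (simp add: q_def powr_powr powr_half_sqrt)
    finally show ?thesis .
  qed
  finally show "damped_weight n \<epsilon> a \<xi> \<le> ?K * sqrt (\<zeta> / \<xi>) * damped_weight n \<epsilon> a \<zeta>"
    using damped_weight_pos[of \<zeta> n \<epsilon> a] x by (simp add: r_def mult_ac mult_left_mono)
qed

section \<open>Measures dominated on intervals\<close>

text \<open>Domination on half-open intervals extends to Borel sets. An inequality does not define a
  Dynkin system, but the equation \<open>N + D = G dx\<close> does, where \<open>D\<close> is the Stieltjes measure of the
  nondecreasing function \<open>\<integral> G - cdf N\<close>.\<close>

lemma emeasure_le_nn_integral_Ioc:
  fixes N :: "real measure" and G :: "real \<Rightarrow> real"
  assumes N: "finite_borel_measure N"
    and ab: "a \<le> b" and cont: "continuous_on {a..b} G"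
    and nonneg: "\<And>x. x \<in> {a..b} \<Longrightarrow> 0 \<le> G x"
    and le: "\<And>c d. a \<le> c \<Longrightarrow> c < d \<Longrightarrow> d \<le> b \<Longrightarrow> measure N {c<..d} \<le> integral {c..d} G"
    and A: "A \<in> sets borel"
  shows "emeasure N (A \<inter> {a<..b}) \<le> (\<integral>\<^sup>+x\<in>A \<inter> {a<..b}. ennreal (G x) \<partial>lborel)"
proof -
  interpret finite_borel_measure N by fact
  \<comment> \<open>clamping to \<open>[a, b]\<close> extends the distribution function of the difference to the whole line\<close>
  define cl where "cl x = max a (min b x)" for x
  have cl: "a \<le> cl x" "cl x \<le> b" "x \<le> y \<Longrightarrow> cl x \<le> cl y" for x y
    using ab by (auto simp: cl_def)
  define F where "F x = integral {a..cl x} G - cdf N (cl x)" for x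
  have G_int: "G integrable_on {c..d}" if "a \<le> c" "d \<le> b" for c d
    by (intro integrable_continuous_real continuous_on_subset[OF cont]) (use that in auto)
  have incr: "integral {a..d} G - integral {a..c} G = integral {c..d} G" if "a \<le> c" "c \<le> d" "d \<le> b" for c d
    using Henstock_Kurzweil_Integration.integral_combine[OF that(1,2) G_int[OF order_refl that(3)]] by simp
  have F_diff: "F y - F x = integral {cl x..cl y} G - measure N {cl x<..cl y}" if "x \<le> y" for x y
  proof (cases "cl x = cl y")
    case False
    then have "cl x < cl y" using cl(3)[OF that] by simp
    then show ?thesis
      unfolding F_def using incr[of "cl x" "cl y"] cl[of x] cl[of y] cdf_diff_eq[of "cl x" "cl y"] by simp
  qed (simp add: F_def)
  have F_mono: "F x \<le> F y" if "x \<le> y" for x y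
  proof -
    have "0 \<le> F y - F x"
    proof (cases "cl x = cl y")
      case False
      then have "cl x < cl y" using cl(3)[OF that] by simp
      then show ?thesis unfolding F_diff[OF that] using le[of "cl x" "cl y"] cl by simp
    qed (simp add: F_def)
    then show ?thesis by simp
  qed
  have F_right: "continuous (at_right x) F" for x
  proof -
    have I: "continuous_on UNIV (\<lambda>x. integral {a..cl x} G)"
    proof (rule continuous_on_compose2[where f = cl and g = "\<lambda>x. integral {a..x} G"])
      show "continuous_on {a..b} (\<lambda>x. integral {a..x} G)"
        by (rule indefinite_integral_continuous_1) (rule G_int, auto)
      show "continuous_on UNIV cl" unfolding cl_def[abs_def] by (intro continuous_intros)
    qed (use cl in auto)
    have "((\<lambda>y. cdf N (cl y)) \<longlongrightarrow> cdf N (cl x)) (at_right x)"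
    proof (cases "x < a \<or> b \<le> x")
      case True
      then have "eventually (\<lambda>y. cl y = cl x) (at_right x)"
      proof
        assume "x < a"
        then show ?thesis
          using eventually_at_right_real[of x a] ab
          by (auto elim!: eventually_mono simp: cl_def)
      next
        assume "b \<le> x"
        then show ?thesis
          using eventually_at_right_less[of x] ab
          by (auto elim!: eventually_mono simp: cl_def)
      qed
      then show ?thesis by (intro tendsto_eventually) (auto elim: eventually_mono)
    next
      case False
      have "(cdf N \<longlongrightarrow> cdf N x) (at_right x)"
        using cdf_is_right_cont[of x] by (simp add: continuous_within)
      moreover have "eventually (\<lambda>y. cdf N y = cdf N (cl y)) (at_right x)"
        using eventually_at_right_real[of x b] False ab
        by (auto elim!: eventually_mono simp: cl_def)
      moreover have "cl x = x" using False by (auto simp: cl_def)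
      ultimately show ?thesis by (simp add: filterlim_cong[OF refl refl] tendsto_cong)
    qed
    moreover have "((\<lambda>x. integral {a..cl x} G) \<longlongrightarrow> integral {a..cl x} G) (at_right x)"
      using I by (auto simp: continuous_on_def intro: tendsto_within_subset)
    ultimately show ?thesis
      unfolding continuous_within F_def by (intro tendsto_diff)
  qed
  \<comment> \<open>the deficit \<open>G - N\<close> is a measure as well, since it is nonnegative on half-open intervals\<close>
  define D where "D = interval_measure F"
  have D_Ioc: "emeasure D {c<..d} = F d - F c" if "c \<le> d" for c d
    unfolding D_def by (rule emeasure_interval_measure_Ioc[OF that F_mono F_right])
  define H where "H = density lborel (\<lambda>x. ennreal (G x) * indicator {a<..b} x)"
  have G_meas: "(\<lambda>x. ennreal (G x) * indicator {a<..b} x) \<in> borel_measurable borel"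
  proof -
    have "(\<lambda>x. indicator {a<..b} x *\<^sub>R G x) \<in> borel_measurable borel"
      by (rule borel_measurable_continuous_on_indicator) (auto intro!: continuous_on_subset[OF cont])
    then have "(\<lambda>x. ennreal (indicator {a<..b} x *\<^sub>R G x)) \<in> borel_measurable borel"
      by measurable
    also have "(\<lambda>x. ennreal (indicator {a<..b} x *\<^sub>R G x)) = (\<lambda>x. ennreal (G x) * indicator {a<..b} x)"
      by (auto simp: indicator_def)
    finally show ?thesis .
  qed
  have H_sets: "sets H = sets borel" by (simp add: H_def)
  have H_Ioc: "emeasure H {c<..d} = ennreal (integral {cl c..cl d} G)" if "c \<le> d" for c d
  proof -
    have "emeasure H {c<..d} = (\<integral>\<^sup>+x. ennreal (G x) * indicator {a<..b} x * indicator {c<..d} x \<partial>lborel)"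
      unfolding H_def by (rule emeasure_density) (use G_meas in auto)
    also have "\<dots> = (\<integral>\<^sup>+x. ennreal (G x) * indicator {cl c<..cl d} x \<partial>lborel)"
      by (intro nn_integral_cong) (auto simp: indicator_def cl_def max_def min_def split: if_splits)
    also have "\<dots> = (\<integral>\<^sup>+x. ennreal (G x) * indicator {cl c..cl d} x \<partial>lborel)"
      by (intro nn_integral_cong_AE) (use AE_lborel_singleton[of "cl c"] in \<open>auto elim!: eventually_mono simp: indicator_def\<close>)
    also have "\<dots> = (\<integral>\<^sup>+x. ennreal (indicator {cl c..cl d} x * G x) \<partial>lborel)"
      by (intro nn_integral_cong) (auto simp: indicator_def)
    also have "\<dots> = ennreal (integral {cl c..cl d} G)"
    proof -
      have c: "continuous_on {cl c..cl d} G" by (rule continuous_on_subset[OF cont]) (use cl in auto)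
      have i: "set_integrable lborel {cl c..cl d} G"
        by (rule borel_integrable_atLeastAtMost') (rule c)
      have "(\<integral>\<^sup>+x. ennreal (indicator {cl c..cl d} x * G x) \<partial>lborel)
          = ennreal (\<integral>x. indicator {cl c..cl d} x * G x \<partial>lborel)"
      proof (rule nn_integral_eq_integral)
        show "integrable lborel (\<lambda>x. indicator {cl c..cl d} x * G x)"
          using i by (simp add: set_integrable_def)
        show "AE x in lborel. 0 \<le> indicator {cl c..cl d} x * G x"
          using nonneg cl[of c] cl[of d] by (intro AE_I2) (auto simp: indicator_def intro: order_trans)
      qed
      also have "(\<integral>x. indicator {cl c..cl d} x * G x \<partial>lborel) = integral {cl c..cl d} G"
        using set_borel_integral_eq_integral(2)[OF i] by (simp add: set_lebesgue_integral_def)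
      finally show ?thesis .
    qed
    finally show ?thesis .
  qed
  have N_Ioc: "emeasure N ({c<..d} \<inter> {a<..b}) = ennreal (measure N {cl c<..cl d})" for c d
  proof -
    have "{c<..d} \<inter> {a<..b} = {cl c<..cl d}" by (auto simp: cl_def max_def min_def)
    then show ?thesis by (simp add: emeasure_eq_measure)
  qed
  have key: "emeasure N (A \<inter> {a<..b}) + emeasure D A = emeasure H A"
  proof -
    define G0 where "G0 = (range (\<lambda>(c, d). {c<..d::real}))"
    have As: "A \<in> sigma_sets UNIV G0"
      using A by (simp add: borel_sigma_sets_Ioc G0_def)
    have sb: "sigma_sets UNIV G0 = sets borel" by (simp add: borel_sigma_sets_Ioc G0_def)
    have Ioc: "emeasure N ({c<..d} \<inter> {a<..b}) + emeasure D {c<..d} = emeasure H {c<..d}" for c d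
    proof (cases "c \<le> d")
      case True
      have "measure N {cl c<..cl d} + (F d - F c) = integral {cl c..cl d} G"
        using F_diff[OF True] by simp
      then show ?thesis
        unfolding N_Ioc D_Ioc[OF True] H_Ioc[OF True]
        using F_mono[OF True] by (simp flip: ennreal_plus)
    qed simp
    have tot: "emeasure N {a<..b} + emeasure D UNIV = emeasure H UNIV \<and> emeasure H UNIV < \<infinity>"
    proof -
      have lim: "(\<Union>i::nat. {- real i<..real i}) = UNIV"
        by (auto simp: set_eq_iff) (metis abs_le_iff abs_less_iff reals_Archimedean2 less_imp_le minus_less_iff)
      have "(\<lambda>i. emeasure N ({- real i<..real i} \<inter> {a<..b}) + emeasure D {- real i<..real i})
            \<longlonglongrightarrow> emeasure N (\<Union>i::nat. {- real i<..real i} \<inter> {a<..b}) + emeasure D (\<Union>i::nat. {- real i<..real i})"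
        by (intro tendsto_add Lim_emeasure_incseq) (auto simp: incseq_def D_def)
      moreover have "(\<lambda>i. emeasure H {- real i<..real i}) \<longlonglongrightarrow> emeasure H (\<Union>i::nat. {- real i<..real i})"
        by (intro Lim_emeasure_incseq) (auto simp: incseq_def H_sets)
      ultimately have e: "emeasure N (\<Union>i::nat. {- real i<..real i} \<inter> {a<..b}) + emeasure D (\<Union>i::nat. {- real i<..real i})
          = emeasure H (\<Union>i::nat. {- real i<..real i})"
        unfolding Ioc by (rule LIMSEQ_unique)
      have "(\<Union>i::nat. {- real i<..real i} \<inter> {a<..b}) = {a<..b}" using lim by blast
      moreover have "emeasure H UNIV = emeasure H {a<..b}"
        unfolding H_def using G_meas
        by (auto simp: emeasure_density intro!: nn_integral_cong split: split_indicator)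
      ultimately show ?thesis using e lim H_Ioc[OF ab] by simp
    qed
    have Is: "Int_stable G0"
      unfolding Int_stable_def G0_def
    proof safe
      fix c d c' d' :: real
      have "{c<..d} \<inter> {c'<..d'} = (\<lambda>(c, d). {c<..d}) (max c c', min d d')" by auto
      then show "{c<..d} \<inter> {c'<..d'} \<in> range (\<lambda>(c, d). {c<..d})" by blast
    qed
    have "G0 \<subseteq> Pow UNIV" by simp
    from Is this As show ?thesis
    proof (induction A rule: sigma_sets_induct_disjoint)
      case (basic A)
      then show ?case using Ioc by (auto simp: G0_def)
    next
      case (compl A)
      then have [measurable]: "A \<in> sets borel" using sb by simp
      have fin: "emeasure N (A \<inter> {a<..b}) + emeasure D A < \<infinity>"
        unfolding compl(2) using tot emeasure_mono[of A UNIV H] H_sets by (auto intro: le_less_trans)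
      have "(emeasure N ((UNIV - A) \<inter> {a<..b}) + emeasure D (UNIV - A)) + (emeasure N (A \<inter> {a<..b}) + emeasure D A)
          = (emeasure N ((UNIV - A) \<inter> {a<..b}) + emeasure N (A \<inter> {a<..b})) + (emeasure D (UNIV - A) + emeasure D A)"
        by (simp add: ac_simps)
      also have "emeasure N ((UNIV - A) \<inter> {a<..b}) + emeasure N (A \<inter> {a<..b}) = emeasure N {a<..b}"
        by (subst plus_emeasure) (auto intro!: arg_cong[where f = "emeasure N"])
      also have "emeasure D (UNIV - A) + emeasure D A = emeasure D UNIV"
        by (subst plus_emeasure) (auto simp: D_def)
      also have "emeasure N {a<..b} + emeasure D UNIV = emeasure H (UNIV - A) + emeasure H A"
        using tot by (subst plus_emeasure) (auto simp: H_sets)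
      finally show ?case using fin unfolding compl(2) by (auto simp: ennreal_add_left_cancel add.commute[of _ "emeasure H A"])
    next
      case (union A)
      then have m: "A i \<in> sets borel" for i using sb by auto
      have "emeasure N ((\<Union>i. A i) \<inter> {a<..b}) = (\<Sum>i. emeasure N (A i \<inter> {a<..b}))"
        using m union(1) by (subst suminf_emeasure)
          (auto simp: disjoint_family_on_def intro!: arg_cong[where f = "emeasure N"])
      moreover have "emeasure D (\<Union>i. A i) = (\<Sum>i. emeasure D (A i))"
        using m union(1) by (subst suminf_emeasure) (auto simp: D_def)
      moreover have "emeasure H (\<Union>i. A i) = (\<Sum>i. emeasure H (A i))"
        using m union(1) by (subst suminf_emeasure) (auto simp: H_sets)
      ultimately show ?case
        using union(3) by (simp add: suminf_add)
    qed (auto simp: G0_def)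
  qed
  have "emeasure N (A \<inter> {a<..b}) \<le> emeasure H A"
    unfolding key[symmetric] by simp
  also have "emeasure H A = (\<integral>\<^sup>+x\<in>A \<inter> {a<..b}. ennreal (G x) \<partial>lborel)"
    unfolding H_def using A G_meas
    by (auto simp: emeasure_density intro!: nn_integral_cong split: split_indicator)
  finally show ?thesis .
qed

lemma emeasure_le_nn_integral_Ioi:
  fixes N :: "real measure" and G :: "real \<Rightarrow> real"
  assumes N: "finite_borel_measure N" and cont: "continuous_on {0<..} G"
    and nonneg: "\<And>x. 0 < x \<Longrightarrow> 0 \<le> G x"
    and le: "\<And>c d. 0 < c \<Longrightarrow> c < d \<Longrightarrow> measure N {c<..d} \<le> integral {c..d} G"
    and A: "A \<in> sets borel"
  shows "emeasure N (A \<inter> {0<..}) \<le> (\<integral>\<^sup>+x\<in>A \<inter> {0<..}. ennreal (G x) \<partial>lborel)"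
proof -
  interpret finite_borel_measure N by fact
  define B where "B k = A \<inter> {1 / real (Suc k)<..real (Suc k)}" for k
  have B: "B k \<in> sets N" for k using A by (simp add: B_def M_is_borel)
  have inc: "incseq B"
  proof (rule incseq_SucI)
    fix k
    have "1 / real (Suc (Suc k)) \<le> 1 / real (Suc k)" by (simp add: field_simps)
    then show "B k \<subseteq> B (Suc k)" by (auto simp: B_def)
  qed
  have U: "(\<Union>k. B k) = A \<inter> {0<..}"
  proof (intro equalityI subsetI)
    fix x assume "x \<in> (\<Union>k. B k)"
    then show "x \<in> A \<inter> {0<..}" by (auto simp: B_def intro: less_trans[of 0 "1 / real (Suc _)"])
  next
    fix x assume x: "x \<in> A \<inter> {0<..}"
    obtain k where k: "max x (1 / x) < real k" using reals_Archimedean2 by blast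
    have "1 / real (Suc k) < x" using x k by (auto simp: field_simps)
    moreover have "x \<le> real (Suc k)" using k by simp
    ultimately have "x \<in> B k" using x by (simp add: B_def)
    then show "x \<in> (\<Union>k. B k)" by blast
  qed
  have "emeasure N (B k) \<le> (\<integral>\<^sup>+x\<in>A \<inter> {0<..}. ennreal (G x) \<partial>lborel)" for k
  proof -
    have k: "0 < 1 / real (Suc k)" by simp
    have k': "1 / real (Suc k) \<le> real (Suc k)" by (simp add: field_simps)
    have "emeasure N (B k) \<le> (\<integral>\<^sup>+x\<in>A \<inter> {1 / real (Suc k)<..real (Suc k)}. ennreal (G x) \<partial>lborel)"
      unfolding B_def
    proof (rule emeasure_le_nn_integral_Ioc[OF N k' _ _ _ A])
      show "continuous_on {1 / real (Suc k)..real (Suc k)} G"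
        by (rule continuous_on_subset[OF cont]) (auto simp del: of_nat_Suc intro: less_le_trans[OF k])
    qed (auto intro!: nonneg le simp del: of_nat_Suc intro: less_le_trans[OF k])
    also have "\<dots> \<le> (\<integral>\<^sup>+x\<in>A \<inter> {0<..}. ennreal (G x) \<partial>lborel)"
      by (intro nn_integral_mono) (auto simp: indicator_def simp del: of_nat_Suc dest: less_trans[OF k])
    finally show ?thesis .
  qed
  then have "(SUP k. emeasure N (B k)) \<le> (\<integral>\<^sup>+x\<in>A \<inter> {0<..}. ennreal (G x) \<partial>lborel)"
    by (intro SUP_least)
  then show ?thesis
    using SUP_emeasure_incseq[OF _ inc, of N] image_subsetI[of UNIV B, OF B] U by simp
qed

text \<open>The density is chosen below \<open>G\<close> at every point: where a Radon-Nikodym derivative exceeds \<open>G\<close>,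
  which happens on a null set only, it is replaced by 0.\<close>

lemma density_exists_of_emeasure_le:
  fixes N :: "real measure" and G :: "real \<Rightarrow> real"
  assumes N: "finite_borel_measure N" and G[measurable]: "G \<in> borel_measurable borel"
    and nonneg: "\<And>x. 0 \<le> G x"
    and le: "\<And>A. A \<in> sets borel \<Longrightarrow> emeasure N A \<le> (\<integral>\<^sup>+x\<in>A. ennreal (G x) \<partial>lborel)"
  obtains p :: "real \<Rightarrow> real" where "p \<in> borel_measurable borel" "\<And>x. 0 \<le> p x" "\<And>x. p x \<le> G x"
    "N = density lborel (\<lambda>x. ennreal (p x))"
proof -
  interpret finite_borel_measure N by fact
  have sN: "sets N = sets lborel" by (simp add: M_is_borel)
  have ac: "absolutely_continuous lborel N"
    unfolding absolutely_continuous_def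
  proof
    fix A :: "real set" assume A: "A \<in> null_sets lborel"
    then have [measurable]: "A \<in> sets borel" by auto
    have "(\<integral>\<^sup>+x\<in>A. ennreal (G x) \<partial>lborel) = 0"
      using A by (subst nn_integral_0_iff_AE) (auto dest!: AE_not_in elim!: eventually_mono)
    then have "emeasure N A = 0" using le[of A] by simp
    then show "A \<in> null_sets N" by (auto simp: M_is_borel)
  qed
  obtain f where f[measurable]: "f \<in> borel_measurable lborel" and Nf: "density lborel f = N"
    using sigma_finite_measure.Radon_Nikodym[OF sigma_finite_lborel ac sN] by blast
  define B where "B = {x. ennreal (G x) < f x}"
  have [measurable]: "B \<in> sets borel"
    unfolding B_def using f by measurable
  have NB: "emeasure N B = (\<integral>\<^sup>+x\<in>B. f x \<partial>lborel)"
    by (subst Nf[symmetric], subst emeasure_density) auto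
  have "(\<integral>\<^sup>+x\<in>B. ennreal (G x) \<partial>lborel) \<le> emeasure N B"
    unfolding NB by (intro nn_integral_mono) (auto simp: B_def indicator_def)
  then have eq: "emeasure N B = (\<integral>\<^sup>+x\<in>B. ennreal (G x) \<partial>lborel)"
    using le[of B] by (simp add: order_antisym)
  have "(\<integral>\<^sup>+x. (f x * indicator B x - ennreal (G x) * indicator B x) \<partial>lborel)
      = (\<integral>\<^sup>+x\<in>B. f x \<partial>lborel) - (\<integral>\<^sup>+x\<in>B. ennreal (G x) \<partial>lborel)"
    using eq emeasure_finite[of B]
    by (intro nn_integral_diff) (auto simp: B_def indicator_def)
  also have "\<dots> = 0" using eq NB emeasure_finite[of B] by (simp add: ennreal_minus_eq_0)
  finally have "AE x in lborel. f x * indicator B x - ennreal (G x) * indicator B x = 0"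
    by (subst (asm) nn_integral_0_iff_AE) auto
  then have AE: "AE x in lborel. x \<notin> B"
  proof eventually_elim
    case (elim x)
    show ?case
    proof
      assume x: "x \<in> B"
      then have "f x \<le> ennreal (G x)" using elim by (intro ennreal_minus_eq_0) simp
      then show False using x by (simp add: B_def)
    qed
  qed
  define p where "p x = (if x \<in> B then 0 else enn2real (f x))" for x
  show ?thesis
  proof
    show "p \<in> borel_measurable borel" unfolding p_def using f by measurable
    show "0 \<le> p x" for x by (simp add: p_def)
    have fin: "ennreal (enn2real (f x)) = f x" if "x \<notin> B" for x
      using that by (auto simp: B_def not_less intro!: ennreal_enn2real intro: le_less_trans)
    show "p x \<le> G x" for x
    proof (cases "x \<in> B")
      case False
      then have "ennreal (p x) \<le> ennreal (G x)" using fin[OF False] by (simp add: p_def B_def not_less)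
      then show ?thesis using nonneg by simp
    qed (use nonneg in \<open>simp add: p_def\<close>)
    have "density lborel f = density lborel (\<lambda>x. ennreal (p x))"
    proof (rule density_cong)
      show "(\<lambda>x. ennreal (p x)) \<in> borel_measurable lborel" unfolding p_def using f by measurable
      show "AE x in lborel. f x = ennreal (p x)" using AE by eventually_elim (simp add: p_def fin)
    qed (rule f)
    then show "N = density lborel (\<lambda>x. ennreal (p x))" using Nf by simp
  qed
qed

section \<open>Fourier inversion without the sine part\<close>

text \<open>The function \<open>\<bar>\<Sum>\<^sub>j\<^sub><\<^sub>m exp (i j L (x - a))\<bar>\<^sup>2\<close> is nonnegative and equals \<open>m\<^sup>2\<close> at \<open>x = a\<close>. Its expectation
  is a double sum of values of the characteristic function, at most \<open>m + m\<^sup>2 \<delta>\<close> for \<open>L\<close> large.\<close>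

lemma (in real_distribution) no_atoms_of_char_vanishing:
  assumes lim: "\<And>\<delta>. 0 < \<delta> \<Longrightarrow> \<exists>L>0. \<forall>\<xi>. L \<le> \<bar>\<xi>\<bar> \<longrightarrow> cmod (char M \<xi>) \<le> \<delta>"
  shows "measure M {a} = 0"
proof -
  have "measure M {a} \<le> 0 + e" if e: "0 < e" for e
  proof -
    define \<delta> where "\<delta> = e / 2"
    have \<delta>: "0 < \<delta>" using e by (simp add: \<delta>_def)
    obtain L where L: "0 < L" "\<And>\<xi>. L \<le> \<bar>\<xi>\<bar> \<Longrightarrow> cmod (char M \<xi>) \<le> \<delta>"
      using lim[OF \<delta>] by blast
    obtain m :: nat where m: "1 / \<delta> < real m" using reals_Archimedean2 by blast
    then have m0: "0 < real m" using \<delta> by (meson less_trans zero_less_divide_1_iff)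
    \<comment> \<open>frequencies in an arithmetic progression of step \<open>L\<close>: off the diagonal all differences are \<open>\<ge> L\<close>\<close>
    define S where "S x = (\<Sum>j<m. iexp (real j * L * (x - a)))" for x
    define \<theta> where "\<theta> j k = (real j - real k) * L" for j k :: nat
    have tm: "iexp (real j * L * (x - a)) * cnj (iexp (real k * L * (x - a)))
        = iexp (\<theta> j k * x) * iexp (- (\<theta> j k * a))" for j k x
      by (simp add: \<theta>_def exp_cnj exp_add[symmetric] algebra_simps)
    have sq: "complex_of_real ((cmod (S x))\<^sup>2)
        = (\<Sum>j<m. \<Sum>k<m. iexp (\<theta> j k * x) * iexp (- (\<theta> j k * a)))" for x
      unfolding complex_norm_square S_def cnj_sum sum_product
      by (intro sum.cong refl) (simp only: tm)
    have int: "integrable M (\<lambda>x. iexp (\<theta> j k * x) * iexp (- (\<theta> j k * a)))" for j k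
      by (intro integrable_mult_left integrable_iexp) auto
    have "complex_of_real (\<integral>x. (cmod (S x))\<^sup>2 \<partial>M) = (\<integral>x. complex_of_real ((cmod (S x))\<^sup>2) \<partial>M)"
      by (rule integral_complex_of_real[symmetric])
    also have "\<dots> = (\<Sum>j<m. \<Sum>k<m. char M (\<theta> j k) * iexp (- (\<theta> j k * a)))"
      unfolding sq by (subst Bochner_Integration.integral_sum, use int in \<open>auto simp: char_def\<close>)
    finally have eq: "complex_of_real (\<integral>x. (cmod (S x))\<^sup>2 \<partial>M) = (\<Sum>j<m. \<Sum>k<m. char M (\<theta> j k) * iexp (- (\<theta> j k * a)))" .
    have "(\<integral>x. (cmod (S x))\<^sup>2 \<partial>M) \<le> cmod (complex_of_real (\<integral>x. (cmod (S x))\<^sup>2 \<partial>M))"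
      by simp
    also have "\<dots> \<le> (\<Sum>j<m. \<Sum>k<m. cmod (char M (\<theta> j k) * iexp (- (\<theta> j k * a))))"
      unfolding eq by (intro sum_norm_le norm_sum)
    also have "\<dots> \<le> (\<Sum>j<m. \<Sum>k<m. (if j = k then 1 else 0) + \<delta>)"
    proof (intro sum_mono)
      fix j k
      have c1: "cmod (char M (\<theta> j k) * iexp (- (\<theta> j k * a))) = cmod (char M (\<theta> j k))"
        by (simp only: norm_mult norm_exp_i_times mult_1_right)
      show "cmod (char M (\<theta> j k) * iexp (- (\<theta> j k * a))) \<le> (if j = k then 1 else 0) + \<delta>"
      proof (cases "j = k")
        case True
        then show ?thesis unfolding c1 using cmod_char_le_1[of "\<theta> j k"] \<delta> by simp
      next
        case False
        then have "1 \<le> \<bar>real j - real k\<bar>" by linarith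
        then have "L \<le> \<bar>\<theta> j k\<bar>" using L(1) by (simp add: \<theta>_def abs_mult)
        then show ?thesis unfolding c1 using L(2) False by simp
      qed
    qed
    also have "\<dots> = real m + (real m)\<^sup>2 * \<delta>"
      by (simp add: sum.distrib power2_eq_square algebra_simps)
    finally have up: "(\<integral>x. (cmod (S x))\<^sup>2 \<partial>M) \<le> real m + (real m)\<^sup>2 * \<delta>" .
    have S_bd: "cmod (S x) \<le> real m" for x
    proof -
      have "cmod (S x) \<le> (\<Sum>j<m. cmod (iexp (real j * L * (x - a))))" unfolding S_def by (rule norm_sum)
      also have "\<dots> = real m" by (simp only: norm_exp_i_times) simp
      finally show ?thesis .
    qed
    have "(\<integral>x. (real m)\<^sup>2 * indicator {a} x \<partial>M) \<le> (\<integral>x. (cmod (S x))\<^sup>2 \<partial>M)"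
    proof (rule integral_mono)
      show "integrable M (\<lambda>x. (real m)\<^sup>2 * indicator {a} x)" by (simp add: less_top[symmetric])
      show "integrable M (\<lambda>x. (cmod (S x))\<^sup>2)"
        by (rule integrable_const_bound[of _ "(real m)\<^sup>2"])
           (use S_bd in \<open>auto simp: S_def[abs_def] intro!: power_mono\<close>)
      show "(real m)\<^sup>2 * indicator {a} x \<le> (cmod (S x))\<^sup>2" for x
        by (auto simp: indicator_def S_def)
    qed
    then have "(real m)\<^sup>2 * measure M {a} \<le> real m + (real m)\<^sup>2 * \<delta>" using up by simp
    then have "real m * (real m * measure M {a}) \<le> real m * (1 + real m * \<delta>)"
      by (simp add: power2_eq_square algebra_simps)
    then have "real m * measure M {a} \<le> 1 + real m * \<delta>"
      using m0 by (rule mult_left_le_imp_le)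
    then have "measure M {a} \<le> 1 / real m + \<delta>"
      using m0 by (simp add: field_simps)
    also have "1 / real m \<le> \<delta>" using m m0 \<delta> by (simp add: field_simps)
    finally show ?thesis by (simp add: \<delta>_def)
  qed
  then have "measure M {a} \<le> 0" by (rule field_le_epsilon)
  then show ?thesis by (simp add: measure_le_0_iff)
qed

lemma char_uminus_cnj: "char M (- t) = cnj (char M t)"
proof -
  have "char M (- t) = (CLINT x|M. cnj (iexp (t * x)))"
    unfolding char_def by (intro Bochner_Integration.integral_cong refl) (simp add: exp_cnj)
  then show ?thesis by (simp add: char_def)
qed

text \<open>The inversion kernels of \<open>(c, d]\<close> and of its mirror image \<open>(- d, - c]\<close> add up to a real function.\<close>

lemma Levy_kernel:
  fixes t c d :: real
  shows "(iexp (- (t * c)) - iexp (- (t * d))) / (\<i> * t) + (iexp (t * d) - iexp (t * c)) / (\<i> * t)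
    = complex_of_real (2 * ((sin (d * t) - sin (c * t)) / t))"
proof -
  have e: "iexp y = iexp (- y) + 2 * \<i> * complex_of_real (sin y)" for y :: real
    by (simp add: complex_eq_iff Re_exp Im_exp)
  have "(iexp (- (t * c)) - iexp (- (t * d))) + (iexp (t * d) - iexp (t * c))
      = \<i> * complex_of_real (2 * (sin (t * d) - sin (t * c)))"
    unfolding e[of "t * d"] e[of "t * c"] by (simp add: algebra_simps)
  then have "((iexp (- (t * c)) - iexp (- (t * d))) + (iexp (t * d) - iexp (t * c))) / (\<i> * t)
      = complex_of_real (2 * (sin (t * d) - sin (t * c))) / complex_of_real t"
    by simp
  then show ?thesis by (simp only: add_divide_distrib mult.commute[of d] mult.commute[of c]
      of_real_divide[symmetric] times_divide_eq_right)
qed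

text \<open>Bounding the measure of \<open>(c, d]\<close> by that of its union with the mirror image leaves only the real
  part of the characteristic function.\<close>

lemma (in real_distribution) measure_Ioc_le_of_cosine_transform:
  fixes G e :: "real \<Rightarrow> real"
  assumes atoms: "\<And>x. measure M {x} = 0"
    and cd: "0 < c" "c \<le> d"
    and cont: "continuous_on {c..d} G"
    and bound: "eventually (\<lambda>T. \<forall>x\<in>{c..d}. \<bar>integral {0..T} (\<lambda>\<xi>. cos (x * \<xi>) * Re (char M \<xi>))\<bar> \<le> G x + e T) at_top"
    and e: "(e \<longlongrightarrow> 0) at_top"
  shows "measure M {c<..d} \<le> integral {c..d} G"
proof -
  let ?u = "\<lambda>\<xi>. Re (char M \<xi>)"
  let ?f = "\<lambda>c d t. (iexp (-(t * c)) - iexp (-(t * d))) / (\<i> * t) * char M t"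
  let ?k = "\<lambda>t. integral {c..d} (\<lambda>x. cos (x * t))"
  have Re_m: "Re (complex_of_real r * z) = r * Re z" for r z by simp
  have u_cont: "continuous_on S ?u" for S
    by (intro continuous_intros continuous_at_imp_continuous_on ballI isCont_char)
  have even: "?u (- t) = ?u t" for t by (simp add: char_uminus_cnj)
  have k_eq: "?k t = (sin (d * t) - sin (c * t)) / t" if "t \<noteq> 0" for t
  proof (rule integral_unique)
    have "((\<lambda>x. cos (x * t)) has_integral (sin (d * t) / t - sin (c * t) / t)) {c..d}"
      by (rule fundamental_theorem_of_calculus[OF cd(2)])
         (auto intro!: derivative_eq_intros simp: that simp flip: has_real_derivative_iff_has_vector_derivative)
    then show "((\<lambda>x. cos (x * t)) has_integral ((sin (d * t) - sin (c * t)) / t)) {c..d}"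
      by (simp add: diff_divide_distrib)
  qed
  have k_cont: "continuous_on S ?k" for S
    by (rule integral_continuous_on_param[where a = c and b = d and U = S, unfolded cbox_interval])
       (auto intro!: continuous_intros simp: split_beta)
  have int: "set_integrable lborel {- T..T} (?f c d)" if "c \<le> d" for c d T :: real
  proof -
    have meas: "set_borel_measurable lborel {- T..T} (?f c d)"
      unfolding set_borel_measurable_def by measurable
    have b: "AE t in lborel. t \<in> {- T..T} \<longrightarrow> cmod (?f c d t) \<le> d - c"
    proof (rule AE_I2, rule impI)
      fix t assume "t \<in> {- T..T}"
      show "cmod (?f c d t) \<le> d - c"
      proof (cases "t = 0")
        case False
        have "cmod ((iexp (t * - c) - iexp (t * - d)) / (\<i> * t)) \<le> d - c"
          using Levy_Inversion_aux2[of "- d" "- c" t] False that by simp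
        then have "cmod (?f c d t) \<le> (d - c) * 1"
          unfolding norm_mult using cmod_char_le_1[of t] \<open>c \<le> d\<close> by (intro mult_mono) auto
        then show ?thesis by simp
      qed (use that in simp)
    qed
    have ind: "integrable lborel (indicat_real {- T..T})"
      by (rule integrable_real_indicator) (auto simp: emeasure_lborel_Icc_eq)
    show ?thesis
      unfolding set_integrable_def
      by (rule Bochner_Integration.integrable_bound[where f = "\<lambda>t. (d - c) * indicator {- T..T} t"])
         (use meas b ind in \<open>auto simp: set_borel_measurable_def elim!: eventually_mono split: split_indicator\<close>)
  qed
  define J where "J T = integral {c..d} (\<lambda>x. integral {0..T} (\<lambda>\<xi>. cos (x * \<xi>) * ?u \<xi>))" for T
  have Re_form: "Re ((CLBINT t=-T..T. ?f c d t) + (CLBINT t=-T..T. ?f (- d) (- c) t)) = 4 * J T"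
    if T: "0 \<le> T" for T :: real
  proof -
    have le: "- T \<le> T" using T by simp
    have "- d \<le> - c" using cd by simp
    note i = set_borel_integral_eq_integral[OF int[OF cd(2), of T]]
      set_borel_integral_eq_integral[OF int[OF \<open>- d \<le> - c\<close>, of T]]
    have "(CLBINT t=-T..T. ?f c d t) + (CLBINT t=-T..T. ?f (- d) (- c) t)
        = integral {- T..T} (?f c d) + integral {- T..T} (?f (- d) (- c))"
      unfolding i(2,4)[symmetric] interval_integral_Icc[OF le] ..
    also have "\<dots> = integral {- T..T} (\<lambda>t. ?f c d t + ?f (- d) (- c) t)"
      by (rule Henstock_Kurzweil_Integration.integral_add[OF i(1,3), symmetric])
    finally have "Re ((CLBINT t=-T..T. ?f c d t) + (CLBINT t=-T..T. ?f (- d) (- c) t))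
        = Re (integral {- T..T} (\<lambda>t. ?f c d t + ?f (- d) (- c) t))"
      by (rule arg_cong)
    also have "\<dots> = integral {- T..T} (Re \<circ> (\<lambda>t. ?f c d t + ?f (- d) (- c) t))"
      by (rule integral_linear[OF integrable_add[OF i(1,3)] bounded_linear_Re, symmetric])
    also have "\<dots> = integral {- T..T} (\<lambda>t. 2 * (?k t * ?u t))"
    proof (rule integral_spike[of "{0}"])
      fix t assume "t \<in> {- T..T} - {0}"
      then have "t \<noteq> 0" by simp
      have "?f c d t + ?f (- d) (- c) t
          = ((iexp (- (t * c)) - iexp (- (t * d))) / (\<i> * t) + (iexp (t * d) - iexp (t * c)) / (\<i> * t)) * char M t"
        unfolding distrib_right mult_minus_right minus_minus ..
      also have "\<dots> = complex_of_real (2 * ?k t) * char M t"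
        unfolding Levy_kernel k_eq[OF \<open>t \<noteq> 0\<close>] ..
      finally have *: "?f c d t + ?f (- d) (- c) t = complex_of_real (2 * ?k t) * char M t" .
      show "2 * (?k t * ?u t) = (Re \<circ> (\<lambda>t. ?f c d t + ?f (- d) (- c) t)) t"
        by (simp only: o_apply * Re_m mult.assoc)
    qed simp
    also have "\<dots> = 2 * integral {- T..T} (\<lambda>t. ?k t * ?u t)" by (simp only: integral_mult_right)
    finally have Re_eq: "Re ((CLBINT t=-T..T. ?f c d t) + (CLBINT t=-T..T. ?f (- d) (- c) t))
        = 2 * integral {- T..T} (\<lambda>t. ?k t * ?u t)" .
    have split: "integral {- T..0} (\<lambda>t. ?k t * ?u t) + integral {0..T} (\<lambda>t. ?k t * ?u t) = integral {- T..T} (\<lambda>t. ?k t * ?u t)"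
      by (rule Henstock_Kurzweil_Integration.integral_combine)
         (use T in \<open>auto intro!: integrable_continuous_real continuous_on_mult k_cont u_cont\<close>)
    have mirror: "integral {- T..0} (\<lambda>t. ?k t * ?u t) = integral {0..T} (\<lambda>t. ?k t * ?u t)"
      using Henstock_Kurzweil_Integration.integral_reflect_real[of T 0 "\<lambda>t. ?k t * ?u t"] by (simp add: even)
    have "continuous_on (cbox (0, c) (T, d)) (\<lambda>(t, x). cos (x * t) * ?u t)"
      unfolding split_beta by (intro continuous_intros continuous_on_compose2[OF u_cont[of UNIV]]) auto
    from integral_swap_continuous[OF this]
    have "integral {0..T} (\<lambda>t. ?k t * ?u t) = J T"
      unfolding J_def cbox_interval integral_mult_left .
    then show ?thesis using Re_eq split mirror by linarith
  qed
  have J_le: "eventually (\<lambda>T. \<bar>J T\<bar> \<le> integral {c..d} G + (d - c) * e T) at_top"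
    using bound eventually_ge_at_top[of 0]
  proof eventually_elim
    case (elim T)
    have cc: "continuous_on {c..d} (\<lambda>x. integral {0..T} (\<lambda>\<xi>. cos (x * \<xi>) * ?u \<xi>))"
      by (rule integral_continuous_on_param[where a = 0 and b = T and U = "{c..d}", unfolded cbox_interval])
         (unfold split_beta, intro continuous_intros continuous_on_compose2[OF u_cont[of UNIV]], auto)
    have "norm (J T) \<le> integral {c..d} (\<lambda>x. G x + e T)"
      unfolding J_def
      by (rule integral_norm_bound_integral)
         (use elim in \<open>auto intro!: integrable_continuous_real cc continuous_intros cont\<close>)
    also have "\<dots> = integral {c..d} G + (d - c) * e T"
      using cd by (subst Henstock_Kurzweil_Integration.integral_add)
        (auto intro!: integrable_continuous_real cont)
    finally show ?case by simp
  qed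
  have L: "(\<lambda>T::nat. Re (1 / (2 * pi) * (CLBINT t=-real T..real T. ?f c d t) + 1 / (2 * pi) * (CLBINT t=-real T..real T. ?f (- d) (- c) t)))
      \<longlonglongrightarrow> Re (complex_of_real (measure M {c<..d}) + complex_of_real (measure M {- d<..- c}))"
  proof -
    have "- d \<le> - c" using cd by simp
    from tendsto_Re[OF tendsto_add[OF Levy_Inversion[OF cd(2) atoms atoms] Levy_Inversion[OF this atoms atoms]]]
    show ?thesis unfolding of_int_minus of_int_of_nat_eq .
  qed
  have L_eq: "Re (1 / (2 * pi) * (CLBINT t=-real T..real T. ?f c d t) + 1 / (2 * pi) * (CLBINT t=-real T..real T. ?f (- d) (- c) t))
      = 2 / pi * J (real T)" for T
  proof -
    have "Re (1 / (2 * pi) * (CLBINT t=-real T..real T. ?f c d t) + 1 / (2 * pi) * (CLBINT t=-real T..real T. ?f (- d) (- c) t))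
      = 1 / (2 * pi) * Re ((CLBINT t=-real T..real T. ?f c d t) + (CLBINT t=-real T..real T. ?f (- d) (- c) t))"
      unfolding distrib_left[symmetric] Re_m[symmetric] by simp
    then show ?thesis using Re_form[of "real T"] by simp
  qed
  have lim: "(\<lambda>T. 2 / pi * J (real T)) \<longlonglongrightarrow> measure M {c<..d} + measure M {- d<..- c}"
    using L unfolding L_eq by simp
  have lim2: "(\<lambda>T. integral {c..d} G + (d - c) * e (real T)) \<longlonglongrightarrow> integral {c..d} G + (d - c) * 0"
    by (intro tendsto_intros filterlim_compose[OF e filterlim_real_sequentially])
  have "eventually (\<lambda>T. 2 / pi * J (real T) \<le> integral {c..d} G + (d - c) * e (real T)) sequentially"
    using filterlim_iff[THEN iffD1, OF filterlim_real_sequentially, rule_format, OF J_le]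
  proof eventually_elim
    case (elim T)
    have "2 / pi * J (real T) \<le> 2 / pi * \<bar>J (real T)\<bar>" by (intro mult_left_mono) auto
    also have "\<dots> \<le> 1 * \<bar>J (real T)\<bar>" using pi_ge_two by (intro mult_right_mono) (auto simp: field_simps)
    finally show ?case using elim by simp
  qed
  then have "measure M {c<..d} + measure M {- d<..- c} \<le> integral {c..d} G + (d - c) * 0"
    using lim lim2 by (intro tendsto_le[OF _ lim2 lim]) auto
  then show ?thesis using measure_nonneg[of M "{- d<..- c}"] by linarith
qed

lemma (in real_distribution) density_of_cosine_transform_bound:
  fixes G :: "real \<Rightarrow> real"
  assumes van: "\<And>\<delta>. 0 < \<delta> \<Longrightarrow> \<exists>L>0. \<forall>\<xi>. L \<le> \<bar>\<xi>\<bar> \<longrightarrow> cmod (char M \<xi>) \<le> \<delta>"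
    and cont: "continuous_on {0<..} G"
    and nonneg: "\<And>x. 0 < x \<Longrightarrow> 0 \<le> G x"
    and bound: "\<And>c d. 0 < c \<Longrightarrow> \<exists>e. (e \<longlongrightarrow> 0) at_top \<and> eventually (\<lambda>T. \<forall>x\<in>{c..d}.
      \<bar>integral {0..T} (\<lambda>\<xi>. cos (x * \<xi>) * Re (char M \<xi>))\<bar> \<le> G x + e T) at_top"
  obtains p :: "real \<Rightarrow> real" where "p \<in> borel_measurable borel" "\<And>x. 0 \<le> p x"
    "\<And>x. x \<noteq> 0 \<Longrightarrow> p x \<le> G \<bar>x\<bar>" "M = density lborel (\<lambda>x. ennreal (p x))"
proof -
  \<comment> \<open>the reflected distribution takes care of the negative half-line\<close>
  define M' where "M' = distr M borel uminus"
  interpret M': real_distribution M'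
    unfolding M'_def by (rule real_distribution_distr) simp
  have char': "char M' \<xi> = cnj (char M \<xi>)" for \<xi>
  proof -
    have "char M' \<xi> = char M (- \<xi>)"
      unfolding M'_def char_def by (subst integral_distr) auto
    then show ?thesis by (simp add: char_uminus_cnj)
  qed
  have le: "measure M {c<..d} \<le> integral {c..d} G" "measure M' {c<..d} \<le> integral {c..d} G"
    if cd: "0 < c" "c < d" for c d
  proof -
    obtain e where e: "(e \<longlongrightarrow> 0) at_top" "eventually (\<lambda>T. \<forall>x\<in>{c..d}.
      \<bar>integral {0..T} (\<lambda>\<xi>. cos (x * \<xi>) * Re (char M \<xi>))\<bar> \<le> G x + e T) at_top"
      using bound[OF cd(1), of d] by blast
    have c: "continuous_on {c..d} G" by (rule continuous_on_subset[OF cont]) (use cd in auto)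
    have "measure M {x} = 0" for x by (rule no_atoms_of_char_vanishing[OF van])
    then show "measure M {c<..d} \<le> integral {c..d} G"
      by (rule measure_Ioc_le_of_cosine_transform[OF _ cd(1) less_imp_le[OF cd(2)] c e(2,1)])
    have "measure M' {x} = 0" for x
      by (rule M'.no_atoms_of_char_vanishing) (use van in \<open>simp add: char'\<close>)
    then show "measure M' {c<..d} \<le> integral {c..d} G"
      by (rule M'.measure_Ioc_le_of_cosine_transform[OF _ cd(1) less_imp_le[OF cd(2)] c _ e(1)])
         (use e(2) in \<open>simp add: char'\<close>)
  qed
  \<comment> \<open>at 0 the bound says nothing; the value 0 there is harmless, since there is no atom\<close>
  define H where "H x = indicator (- {0}) x *\<^sub>R G \<bar>x\<bar>" for x :: real
  have H_meas [measurable]: "H \<in> borel_measurable borel"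
    unfolding H_def[abs_def]
    by (rule borel_measurable_continuous_on_indicator)
       (auto intro!: continuous_on_compose2[OF cont] continuous_intros)
  have H_nonneg: "0 \<le> H x" for x
    using nonneg[of "\<bar>x\<bar>"] by (simp add: H_def indicator_def)
  have dom: "emeasure M A \<le> (\<integral>\<^sup>+x\<in>A. ennreal (H x) \<partial>lborel)" if A: "A \<in> sets borel" for A
  proof -
    note [measurable] = A
    define B where "B = uminus -` A"
    have [measurable]: "B \<in> sets borel"
      unfolding B_def using measurable_sets_borel[of uminus borel A] by simp
    have "emeasure M (A \<inter> {0<..}) \<le> (\<integral>\<^sup>+x\<in>A \<inter> {0<..}. ennreal (G x) \<partial>lborel)"
      by (rule emeasure_le_nn_integral_Ioi[OF finite_borel_measure_M cont nonneg le(1) A])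
    also have "\<dots> = (\<integral>\<^sup>+x\<in>A \<inter> {0<..}. ennreal (H x) \<partial>lborel)"
      by (intro nn_integral_cong) (auto simp: H_def indicator_def)
    finally have pos: "emeasure M (A \<inter> {0<..}) \<le> (\<integral>\<^sup>+x\<in>A \<inter> {0<..}. ennreal (H x) \<partial>lborel)" .
    have "emeasure M (A \<inter> {..<0}) = emeasure M' (B \<inter> {0<..})"
      unfolding M'_def by (subst emeasure_distr) (auto simp: B_def intro!: arg_cong[where f = "emeasure M"])
    also have "\<dots> \<le> (\<integral>\<^sup>+x\<in>B \<inter> {0<..}. ennreal (G x) \<partial>lborel)"
      by (rule emeasure_le_nn_integral_Ioi[OF M'.finite_borel_measure_M cont nonneg le(2)]) auto
    also have "\<dots> = (\<integral>\<^sup>+x\<in>B \<inter> {0<..}. ennreal (H x) \<partial>lborel)"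
      by (intro nn_integral_cong) (auto simp: H_def indicator_def)
    also have "\<dots> = (\<integral>\<^sup>+x\<in>B \<inter> {0<..}. ennreal (H x) \<partial>distr lborel borel uminus)"
      by (simp only: lborel_distr_uminus)
    also have "\<dots> = (\<integral>\<^sup>+x\<in>A \<inter> {..<0}. ennreal (H x) \<partial>lborel)"
    proof -
      have m: "(\<lambda>x. ennreal (H x) * indicator (B \<inter> {0<..}) x) \<in> borel_measurable (distr lborel borel uminus)" by measurable
      show ?thesis
        by (subst nn_integral_distr[OF _ m]) (auto intro!: nn_integral_cong simp: B_def H_def indicator_def)
    qed
    finally have neg: "emeasure M (A \<inter> {..<0}) \<le> (\<integral>\<^sup>+x\<in>A \<inter> {..<0}. ennreal (H x) \<partial>lborel)" .
    have zero: "emeasure M (A \<inter> {0}) = 0"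
    proof -
      have "measure M {0} = 0" by (rule no_atoms_of_char_vanishing[OF van])
      then have "emeasure M {0} = 0" by (simp add: emeasure_eq_measure)
      then show ?thesis by (cases "0 \<in> A") auto
    qed
    have "A = (A \<inter> {0<..} \<union> A \<inter> {..<0}) \<union> A \<inter> {0}" by auto
    then have "emeasure M A = emeasure M ((A \<inter> {0<..} \<union> A \<inter> {..<0}) \<union> A \<inter> {0})" by simp
    also have "\<dots> \<le> emeasure M (A \<inter> {0<..} \<union> A \<inter> {..<0}) + emeasure M (A \<inter> {0})"
      by (intro emeasure_subadditive) auto
    also have "\<dots> \<le> emeasure M (A \<inter> {0<..}) + emeasure M (A \<inter> {..<0})"
      unfolding zero add_0_right by (intro emeasure_subadditive) auto
    also have "\<dots> \<le> (\<integral>\<^sup>+x\<in>A \<inter> {0<..}. ennreal (H x) \<partial>lborel) + (\<integral>\<^sup>+x\<in>A \<inter> {..<0}. ennreal (H x) \<partial>lborel)"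
      by (rule add_mono[OF pos neg])
    also have "\<dots> = (\<integral>\<^sup>+x. ennreal (H x) * indicator (A \<inter> {0<..}) x + ennreal (H x) * indicator (A \<inter> {..<0}) x \<partial>lborel)"
      by (rule nn_integral_add[symmetric]) auto
    also have "\<dots> = (\<integral>\<^sup>+x\<in>A. ennreal (H x) \<partial>lborel)"
      by (intro nn_integral_cong) (auto simp: H_def indicator_def)
    finally show ?thesis .
  qed
  obtain p where p: "p \<in> borel_measurable borel" "\<And>x. 0 \<le> p x" "\<And>x. p x \<le> H x"
    "M = density lborel (\<lambda>x. ennreal (p x))"
    using density_exists_of_emeasure_le[OF finite_borel_measure_M H_meas H_nonneg dom] by blast
  show ?thesis
  proof (rule that[OF p(1,2) _ p(4)])
    show "p x \<le> G \<bar>x\<bar>" if "x \<noteq> 0" for x using p(3)[of x] that by (simp add: H_def)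
  qed
qed

section \<open>A bound for oscillatory integrals\<close>

text \<open>The weight \<open>(R / \<xi>)\<^bsup>1/2\<^esup>\<close>, with \<open>R = 1/x\<close>, in the bound for \<open>\<xi> \<bar>u'(\<xi>)\<bar>\<close> is integrable at 0 with
  integral \<open>2 R\<close>. The derivative \<open>u'\<close> itself may be unbounded at 0.\<close>

lemma oscillatory_integral_bound:
  fixes u u' u'' :: "real \<Rightarrow> real"
  assumes x: "0 < x" and T: "1 / x \<le> T"
    and cont_u: "continuous_on {0..T} u"
    and der: "\<And>\<xi>. 0 < \<xi> \<Longrightarrow> (u has_real_derivative u' \<xi>) (at \<xi>)"
    and der2: "\<And>\<xi>. 0 < \<xi> \<Longrightarrow> (u' has_real_derivative u'' \<xi>) (at \<xi>)"
    and cont_u'': "continuous_on {0<..} u''"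
    and low: "\<And>\<xi>. 0 < \<xi> \<Longrightarrow> \<xi> \<le> 1 / x \<Longrightarrow> \<xi> * \<bar>u' \<xi>\<bar> \<le> A * sqrt (1 / x / \<xi>)"
    and high: "integral {1 / x..T} (\<lambda>\<xi>. \<bar>u'' \<xi>\<bar>) \<le> B"
  shows "\<bar>integral {0..T} (\<lambda>\<xi>. cos (x * \<xi>) * u \<xi>)\<bar>
           \<le> 3 * A / x + B / x\<^sup>2 + (\<bar>u T\<bar> / x + \<bar>u' T\<bar> / x\<^sup>2)"
proof -
  define R where "R = 1 / x"
  have R: "0 < R" "R \<le> T" "x * R = 1"
    using x T by (auto simp: R_def)
  have T0: "0 < T" using R by linarith
  let ?c = "\<lambda>\<xi>. cos (x * \<xi>) * u \<xi>" and ?s = "\<lambda>\<xi>. sin (x * \<xi>) * u' \<xi>"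
  have c_int: "?c integrable_on {0..T}"
    by (intro integrable_continuous_real continuous_intros cont_u)
  have "((\<lambda>\<xi>. x * ?c \<xi> + ?s \<xi>) has_integral (sin (x * T) * u T - sin (x * 0) * u 0)) {0..T}"
  proof (rule fundamental_theorem_of_calculus_interior)
    show "0 \<le> T" using T0 by simp
    show "continuous_on {0..T} (\<lambda>\<xi>. sin (x * \<xi>) * u \<xi>)"
      by (intro continuous_intros cont_u)
    fix \<xi> assume "\<xi> \<in> {0<..<T}"
    then have "(u has_real_derivative u' \<xi>) (at \<xi>)" using der by simp
    then have "((\<lambda>\<xi>. sin (x * \<xi>) * u \<xi>) has_real_derivative x * ?c \<xi> + ?s \<xi>) (at \<xi>)"
      by (auto intro!: derivative_eq_intros simp: algebra_simps)
    then show "((\<lambda>\<xi>. sin (x * \<xi>) * u \<xi>) has_vector_derivative x * ?c \<xi> + ?s \<xi>) (at \<xi>)"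
      by (simp add: has_real_derivative_iff_has_vector_derivative)
  qed
  then have FTC: "((\<lambda>\<xi>. x * ?c \<xi> + ?s \<xi>) has_integral (sin (x * T) * u T)) {0..T}"
    by simp
  have "((\<lambda>\<xi>. (x * ?c \<xi> + ?s \<xi>) - x * ?c \<xi>) has_integral
          (sin (x * T) * u T - x * integral {0..T} ?c)) {0..T}"
    by (intro has_integral_diff FTC has_integral_mult_right integrable_integral c_int)
  then have s: "(?s has_integral (sin (x * T) * u T - x * integral {0..T} ?c)) {0..T}"
    by simp
  have s_int: "?s integrable_on {0..T}" using s by blast
  have split: "integral {0..R} ?s + integral {R..T} ?s = integral {0..T} ?s"
    by (rule Henstock_Kurzweil_Integration.integral_combine) (use R s_int in auto)
  \<comment> \<open>below \<open>1/x\<close> the oscillation is useless, but \<open>\<bar>sin (x \<xi>)\<bar> \<le> x \<xi>\<close> compensates \<open>u'\<close>\<close>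
  have low_int: "((\<lambda>\<xi>. x * (A * sqrt (R / \<xi>))) has_integral (2 * A)) {0..R}"
  proof -
    have "((\<lambda>\<xi>. x * (A * sqrt (R / \<xi>))) has_integral
            (2 * x * A * sqrt (R * R) - 2 * x * A * sqrt (R * 0))) {0..R}"
    proof (rule fundamental_theorem_of_calculus_interior)
      show "0 \<le> R" using R by simp
      show "continuous_on {0..R} (\<lambda>\<xi>. 2 * x * A * sqrt (R * \<xi>))"
        by (intro continuous_intros)
      fix \<xi> assume \<xi>: "\<xi> \<in> {0<..<R}"
      have pos: "0 < R * \<xi>" using \<xi> R by simp
      have "sqrt (R / \<xi>) = R / sqrt (R * \<xi>)"
        using \<xi> R by (simp add: real_sqrt_divide real_sqrt_mult field_simps flip: power2_eq_square)
      moreover have "((\<lambda>\<xi>. sqrt (R * \<xi>)) has_real_derivative inverse (sqrt (R * \<xi>)) / 2 * R) (at \<xi>)"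
        by (rule DERIV_chain2[where f = sqrt and g = "\<lambda>\<xi>. R * \<xi>", OF DERIV_real_sqrt[OF pos]])
           (auto intro!: derivative_eq_intros)
      from DERIV_cmult[OF this, of "2 * x * A"]
      have "((\<lambda>\<xi>. 2 * x * A * sqrt (R * \<xi>)) has_real_derivative x * A * (R / sqrt (R * \<xi>))) (at \<xi>)"
        by (simp add: field_simps)
      ultimately have "((\<lambda>\<xi>. 2 * x * A * sqrt (R * \<xi>)) has_real_derivative x * (A * sqrt (R / \<xi>))) (at \<xi>)"
        by (simp only: mult.assoc)
      then show "((\<lambda>\<xi>. 2 * x * A * sqrt (R * \<xi>)) has_vector_derivative x * (A * sqrt (R / \<xi>))) (at \<xi>)"
        by (simp add: has_real_derivative_iff_has_vector_derivative)
    qed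
    moreover have "2 * x * A * sqrt (R * R) - 2 * x * A * sqrt (R * 0) = 2 * A"
    proof -
      have "sqrt (R * R) = R" using R by simp
      then show ?thesis using R(3) by (simp add: mult.commute[of x A] mult.assoc)
    qed
    ultimately show ?thesis by (simp only:)
  qed
  have sin_le: "\<bar>sin y\<bar> \<le> \<bar>y\<bar>" for y :: real by (rule abs_sin_x_le_abs_x)
  have low': "\<bar>integral {0..R} ?s\<bar> \<le> 2 * A"
  proof -
    have "norm (integral {0..R} ?s) \<le> integral {0..R} (\<lambda>\<xi>. x * (A * sqrt (R / \<xi>)))"
    proof (rule integral_norm_bound_integral)
      show "?s integrable_on {0..R}"
        by (rule integrable_on_subinterval[OF s_int]) (use R in auto)
      show "(\<lambda>\<xi>. x * (A * sqrt (R / \<xi>))) integrable_on {0..R}" using low_int by blast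
      fix \<xi> assume \<xi>: "\<xi> \<in> {0..R}"
      show "norm (?s \<xi>) \<le> x * (A * sqrt (R / \<xi>))"
      proof (cases "\<xi> = 0")
        case False
        then have "0 < \<xi>" using \<xi> by simp
        have "norm (?s \<xi>) \<le> \<bar>x * \<xi>\<bar> * \<bar>u' \<xi>\<bar>"
          unfolding real_norm_def abs_mult by (intro mult_right_mono) (use sin_le[of "x * \<xi>"] in \<open>auto simp: abs_mult\<close>)
        also have "\<dots> = x * (\<xi> * \<bar>u' \<xi>\<bar>)" using x \<open>0 < \<xi>\<close> by (simp add: abs_mult)
        also have "\<dots> \<le> x * (A * sqrt (R / \<xi>))"
          using low[of \<xi>] \<xi> \<open>0 < \<xi>\<close> x by (intro mult_left_mono) (auto simp: R_def)
        finally show ?thesis .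
      qed simp
    qed
    then show ?thesis unfolding integral_unique[OF low_int] by simp
  qed
  \<comment> \<open>above \<open>1/x\<close> a second integration by parts\<close>
  have c''_int: "(\<lambda>\<xi>. cos (x * \<xi>) * u'' \<xi>) integrable_on {R..T}"
    by (intro integrable_continuous_real continuous_intros continuous_on_subset[OF cont_u'']) (use R in auto)
  have abs_int: "(\<lambda>\<xi>. \<bar>u'' \<xi>\<bar>) integrable_on {R..T}"
    by (intro integrable_continuous_real continuous_intros continuous_on_subset[OF cont_u'']) (use R in auto)
  have u'_cont: "continuous_on {R..T} u'"
    by (rule DERIV_continuous_on[of _ _ "u''"], rule DERIV_subset[OF der2]) (use R in auto)
  have "((\<lambda>\<xi>. - x * ?s \<xi> + cos (x * \<xi>) * u'' \<xi>) has_integral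
          (cos (x * T) * u' T - cos (x * R) * u' R)) {R..T}"
  proof (rule fundamental_theorem_of_calculus_interior)
    show "R \<le> T" by fact
    show "continuous_on {R..T} (\<lambda>\<xi>. cos (x * \<xi>) * u' \<xi>)"
      by (intro continuous_intros u'_cont)
    fix \<xi> assume "\<xi> \<in> {R<..<T}"
    then have "(u' has_real_derivative u'' \<xi>) (at \<xi>)" using der2 R by simp
    then have "((\<lambda>\<xi>. cos (x * \<xi>) * u' \<xi>) has_real_derivative - x * ?s \<xi> + cos (x * \<xi>) * u'' \<xi>) (at \<xi>)"
      by (auto intro!: derivative_eq_intros simp: algebra_simps)
    then show "((\<lambda>\<xi>. cos (x * \<xi>) * u' \<xi>) has_vector_derivative - x * ?s \<xi> + cos (x * \<xi>) * u'' \<xi>) (at \<xi>)"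
      by (simp add: has_real_derivative_iff_has_vector_derivative)
  qed
  then have FTC2: "integral {R..T} (\<lambda>\<xi>. - x * ?s \<xi> + cos (x * \<xi>) * u'' \<xi>) = cos (x * T) * u' T - cos (x * R) * u' R"
    by (rule integral_unique)
  have s_int2: "?s integrable_on {R..T}"
    by (rule integrable_on_subinterval[OF s_int]) (use R in auto)
  have "integral {R..T} (\<lambda>\<xi>. - x * ?s \<xi> + cos (x * \<xi>) * u'' \<xi>)
      = - x * integral {R..T} ?s + integral {R..T} (\<lambda>\<xi>. cos (x * \<xi>) * u'' \<xi>)"
    using s_int2 c''_int
    by (subst Henstock_Kurzweil_Integration.integral_add) (auto simp only: integrable_on_mult_right integral_mult_right)
  then have hi_eq: "x * integral {R..T} ?s = integral {R..T} (\<lambda>\<xi>. cos (x * \<xi>) * u'' \<xi>) - cos (x * T) * u' T + cos (x * R) * u' R"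
    using FTC2 by linarith
  have "norm (integral {R..T} (\<lambda>\<xi>. cos (x * \<xi>) * u'' \<xi>)) \<le> integral {R..T} (\<lambda>\<xi>. \<bar>u'' \<xi>\<bar>)"
    by (rule integral_norm_bound_integral[OF c''_int abs_int])
       (auto simp: abs_mult intro!: mult_left_le_one_le)
  then have i1: "\<bar>integral {R..T} (\<lambda>\<xi>. cos (x * \<xi>) * u'' \<xi>)\<bar> \<le> B" using high by (simp add: R_def)
  have i2: "\<bar>cos (x * T) * u' T\<bar> \<le> \<bar>u' T\<bar>" "\<bar>cos (x * R) * u' R\<bar> \<le> \<bar>u' R\<bar>" "\<bar>sin (x * T) * u T\<bar> \<le> \<bar>u T\<bar>"
    by (auto simp: abs_mult intro!: mult_left_le_one_le)
  have "R * \<bar>u' R\<bar> \<le> A" using low[of R] R by (simp add: R_def)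
  then have i3: "\<bar>u' R\<bar> \<le> A * x" using x by (simp add: R_def field_simps)
  have hi: "x * \<bar>integral {R..T} ?s\<bar> \<le> B + \<bar>u' T\<bar> + A * x"
  proof -
    have "x * \<bar>integral {R..T} ?s\<bar> = \<bar>x * integral {R..T} ?s\<bar>" using x by (simp add: abs_mult)
    also have "\<dots> \<le> B + \<bar>u' T\<bar> + A * x" unfolding hi_eq using i1 i2 i3 by linarith
    finally show ?thesis .
  qed
  have "x * integral {0..T} ?c = sin (x * T) * u T - (integral {0..R} ?s + integral {R..T} ?s)"
    using s split by (simp add: integral_unique)
  then have "x * \<bar>integral {0..T} ?c\<bar> = \<bar>sin (x * T) * u T - (integral {0..R} ?s + integral {R..T} ?s)\<bar>"
    using x by (metis abs_mult abs_of_pos)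
  also have "\<dots> \<le> \<bar>u T\<bar> + 2 * A + \<bar>integral {R..T} ?s\<bar>" using i2 low' by linarith
  finally have "x * (x * \<bar>integral {0..T} ?c\<bar>) \<le> x * (\<bar>u T\<bar> + 2 * A + \<bar>integral {R..T} ?s\<bar>)"
    using x by (intro mult_left_mono) auto
  also have "\<dots> \<le> x * \<bar>u T\<bar> + 3 * (A * x) + B + \<bar>u' T\<bar>" using hi by (simp add: algebra_simps)
  finally have "\<bar>integral {0..T} ?c\<bar> \<le> (x * \<bar>u T\<bar> + 3 * (A * x) + B + \<bar>u' T\<bar>) / x\<^sup>2"
    using x by (simp add: pos_le_divide_eq power2_eq_square mult_ac)
  also have "\<dots> = 3 * A / x + B / x\<^sup>2 + (\<bar>u T\<bar> / x + \<bar>u' T\<bar> / x\<^sup>2)"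
    using x by (simp add: add_divide_distrib power2_eq_square)
  finally show ?thesis .
qed

section \<open>The cosine transform of the real part of the characteristic function\<close>

text \<open>The decay claimed for \<open>x \<ge> 1\<close>; \<open>Q\<close> stands for the integrability of \<open>\<bar>\<eta>1''\<bar>\<close> near 0, which
  matters for \<open>\<epsilon> = 1\<close> only.\<close>

definition tail_decay :: "real \<Rightarrow> bool \<Rightarrow> real \<Rightarrow> real" where
  "tail_decay \<epsilon> Q x = (if \<epsilon> < 1 then x powr (- 1 - \<epsilon>)
     else if Q then x powr (- 2) else x powr (- 2) * ln (1 + x))"

text \<open>The bounds for small and for large \<open>x\<close> in one function. Multiplying them, each frozen at \<open>x = 1\<close> outside
  its range, makes the envelope continuous across \<open>x = 1\<close>.\<close>

definition envelope :: "nat \<Rightarrow> real \<Rightarrow> bool \<Rightarrow> real \<Rightarrow> real \<Rightarrow> real" where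
  "envelope n \<epsilon> Q a x =
     1 / min x 1 * damped_weight n \<epsilon> a (1 / min x 1) * tail_decay \<epsilon> Q (max x 1)"

lemma tail_decay_nonneg: "1 \<le> x \<Longrightarrow> 0 \<le> tail_decay \<epsilon> Q x"
  by (simp add: tail_decay_def)

lemma tail_decay_1: "1 / 2 \<le> tail_decay \<epsilon> Q 1" "tail_decay \<epsilon> Q 1 \<le> 1"
  using ln2_ge_two_thirds ln_2_less_1 by (auto simp: tail_decay_def)

lemma envelope_nonneg: "0 < x \<Longrightarrow> 0 \<le> envelope n \<epsilon> Q a x"
  unfolding envelope_def
  by (intro mult_nonneg_nonneg tail_decay_nonneg less_imp_le[OF damped_weight_pos]) auto

lemma continuous_on_envelope: "continuous_on {0<..} (envelope n \<epsilon> Q a)"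
proof -
  have "continuous_on {0<..} (\<lambda>x. tail_decay \<epsilon> Q (max x 1))"
    by (cases "\<epsilon> < 1"; cases Q) (auto simp: tail_decay_def intro!: continuous_intros)
  moreover have "continuous_on {0<..} (\<lambda>x. damped_weight n \<epsilon> a (1 / min x 1))"
    by (rule continuous_on_compose2[OF continuous_on_damped_weight]) (auto intro!: continuous_intros)
  ultimately show ?thesis
    unfolding envelope_def[abs_def] by (intro continuous_intros) auto
qed

lemma damping_tendsto:
  assumes "0 < p" "0 < \<epsilon>"
  shows "((\<lambda>\<xi>. exp (- (p * slog n \<xi> powr \<epsilon>))) \<longlongrightarrow> 0) at_top"
proof (rule filterlim_compose[OF exp_at_bot])
  have "filterlim (\<lambda>\<xi>. slog n \<xi> powr \<epsilon>) at_top at_top"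
  proof (rule filterlim_compose[OF _ slog_at_top])
    have "filterlim (\<lambda>x::real. exp (\<epsilon> * ln x)) at_top at_top"
      by (intro filterlim_compose[OF exp_at_top] filterlim_tendsto_pos_mult_at_top[OF tendsto_const assms(2)] ln_at_top)
    moreover have "eventually (\<lambda>x::real. exp (\<epsilon> * ln x) = x powr \<epsilon>) at_top"
      using eventually_gt_at_top[of 0] by eventually_elim (simp add: powr_def)
    ultimately show "filterlim (\<lambda>x::real. x powr \<epsilon>) at_top at_top"
      by (rule filterlim_mono_eventually[OF _ order_refl order_refl])
  qed
  then have "filterlim (\<lambda>\<xi>. p * slog n \<xi> powr \<epsilon>) at_top at_top"
    by (intro filterlim_tendsto_pos_mult_at_top[OF tendsto_const assms(1)])
  then show "filterlim (\<lambda>\<xi>. - (p * slog n \<xi> powr \<epsilon>)) at_bot at_top"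
    by (simp add: filterlim_uminus_at_top)
qed

text \<open>The hypotheses on the symbol \<open>a + i b\<close>, restricted to the positive half-line, with the derivatives as
  parameters.\<close>

locale log_symbol =
  fixes n :: nat and \<epsilon> \<alpha> c :: real and a b a' b' a'' b'' :: "real \<Rightarrow> real"
  assumes n: "2 \<le> n" and eps: "0 < \<epsilon>" "\<epsilon> \<le> 1" and pos: "0 < \<alpha>" "0 < c"
    and a_ge: "\<And>\<xi>. 0 < \<xi> \<Longrightarrow> \<alpha> * slog n \<xi> powr \<epsilon> \<le> a \<xi>"
    and b_le: "\<And>\<xi>. 0 < \<xi> \<Longrightarrow> \<xi> \<le> 1 \<Longrightarrow> \<bar>b \<xi>\<bar> \<le> c * \<xi> powr \<epsilon>"
    and d1_low: "\<And>\<xi>. 0 < \<xi> \<Longrightarrow> \<xi> \<le> 1 \<Longrightarrow> \<bar>a' \<xi>\<bar> + \<bar>b' \<xi>\<bar> \<le> 2 * c * \<xi> powr (\<epsilon> - 1)"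
    and d1_high: "\<And>\<xi>. 1 \<le> \<xi> \<Longrightarrow> \<bar>a' \<xi>\<bar> + \<bar>b' \<xi>\<bar> \<le> 2 * c * (log_weight n \<epsilon> \<xi> / (1 + \<xi>))"
    and d2_low: "\<And>\<xi>. 0 < \<xi> \<Longrightarrow> \<xi> \<le> 1 \<Longrightarrow> \<bar>a'' \<xi>\<bar> + \<bar>b'' \<xi>\<bar> \<le> 2 * c * \<xi> powr (\<epsilon> - 2)"
    and d2_high: "\<And>\<xi>. 1 \<le> \<xi> \<Longrightarrow> \<bar>a'' \<xi>\<bar> + \<bar>b'' \<xi>\<bar> \<le> 2 * c * (log_weight n \<epsilon> \<xi> / (1 + \<xi>)\<^sup>2)"
    and der_a: "\<And>\<xi>. 0 < \<xi> \<Longrightarrow> (a has_real_derivative a' \<xi>) (at \<xi>)"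
    and der_b: "\<And>\<xi>. 0 < \<xi> \<Longrightarrow> (b has_real_derivative b' \<xi>) (at \<xi>)"
    and der_a': "\<And>\<xi>. 0 < \<xi> \<Longrightarrow> (a' has_real_derivative a'' \<xi>) (at \<xi>)"
    and der_b': "\<And>\<xi>. 0 < \<xi> \<Longrightarrow> (b' has_real_derivative b'' \<xi>) (at \<xi>)"
    and cont_a'': "continuous_on {0<..} a''" and cont_b'': "continuous_on {0<..} b''"
begin

text \<open>The real part of \<open>exp (- t (a + i b))\<close> and its first two derivatives in \<open>\<xi>\<close>.\<close>

definition u :: "real \<Rightarrow> real \<Rightarrow> real" where
  "u t \<xi> = exp (- (t * a \<xi>)) * cos (t * b \<xi>)"

definition u' :: "real \<Rightarrow> real \<Rightarrow> real" where
  "u' t \<xi> = - t * exp (- (t * a \<xi>)) * (a' \<xi> * cos (t * b \<xi>) + b' \<xi> * sin (t * b \<xi>))"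

definition u'' :: "real \<Rightarrow> real \<Rightarrow> real" where
  "u'' t \<xi> = t * exp (- (t * a \<xi>)) *
     (t * a' \<xi> * (a' \<xi> * cos (t * b \<xi>) + b' \<xi> * sin (t * b \<xi>))
      - (a'' \<xi> * cos (t * b \<xi>) - t * a' \<xi> * b' \<xi> * sin (t * b \<xi>)
         + b'' \<xi> * sin (t * b \<xi>) + t * (b' \<xi>)\<^sup>2 * cos (t * b \<xi>)))"

lemma der_u: "0 < \<xi> \<Longrightarrow> (u t has_real_derivative u' t \<xi>) (at \<xi>)"
  unfolding u_def[abs_def] u'_def
  by (auto intro!: derivative_eq_intros der_a der_b simp: algebra_simps)

lemma der_u': "0 < \<xi> \<Longrightarrow> (u' t has_real_derivative u'' t \<xi>) (at \<xi>)"
  unfolding u'_def[abs_def] u''_def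
  by (rule derivative_eq_intros der_a der_b der_a' der_b' refl | assumption)+
     (simp add: algebra_simps power2_eq_square)

lemma cont_u'': "continuous_on {0<..} (u'' t)"
proof -
  have d: "continuous_on {0<..} f" if "\<And>\<xi>. 0 < \<xi> \<Longrightarrow> (f has_real_derivative f' \<xi>) (at \<xi>)" for f f' :: "real \<Rightarrow> real"
    by (rule DERIV_continuous_on[of _ _ f'], rule DERIV_subset[OF that]) auto
  note [continuous_intros] = d[OF der_a] d[OF der_b] d[OF der_a'] d[OF der_b'] cont_a'' cont_b''
  show ?thesis unfolding u''_def[abs_def] by (intro continuous_intros)
qed

lemma abs_mult_trig_le: "\<bar>p * sin y\<bar> \<le> \<bar>p\<bar>" "\<bar>p * cos y\<bar> \<le> \<bar>p\<bar>" for p y :: real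
  unfolding abs_mult by (rule mult_right_le_one_le; simp)+

lemma trig_comb_le: "\<bar>p * cos y + q * sin y\<bar> \<le> \<bar>p\<bar> + \<bar>q\<bar>" for p q y :: real
  using abs_triangle_ineq[of "p * cos y" "q * sin y"] abs_mult_trig_le(2)[of p y] abs_mult_trig_le(1)[of q y]
  by linarith

lemma u_le: "\<bar>u t \<xi>\<bar> \<le> exp (- (t * a \<xi>))"
  using abs_mult_trig_le(2)[of "exp (- (t * a \<xi>))" "t * b \<xi>"] by (simp add: u_def)

lemma u'_le:
  assumes "0 < t"
  shows "\<bar>u' t \<xi>\<bar> \<le> t * exp (- (t * a \<xi>)) * (\<bar>a' \<xi>\<bar> + \<bar>b' \<xi>\<bar>)"
proof -
  have "\<bar>u' t \<xi>\<bar> = t * exp (- (t * a \<xi>)) * \<bar>a' \<xi> * cos (t * b \<xi>) + b' \<xi> * sin (t * b \<xi>)\<bar>"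
    using assms by (simp add: u'_def abs_mult)
  also have "\<dots> \<le> t * exp (- (t * a \<xi>)) * (\<bar>a' \<xi>\<bar> + \<bar>b' \<xi>\<bar>)"
    using assms by (intro mult_left_mono trig_comb_le) simp
  finally show ?thesis .
qed

lemma abs_diff_sum_le:
  "\<bar>p\<bar> \<le> p' \<Longrightarrow> \<bar>q\<bar> \<le> q' \<Longrightarrow> \<bar>r\<bar> \<le> r' \<Longrightarrow> \<bar>s\<bar> \<le> s' \<Longrightarrow> \<bar>v\<bar> \<le> v' \<Longrightarrow>
     \<bar>p - (q - r + s + v)\<bar> \<le> p' + q' + r' + s' + v'" for p q r s v :: real
  by linarith

text \<open>The factor \<open>\<bar>sin (t b)\<bar>\<close> of \<open>\<bar>b''\<bar>\<close> is kept for the case in which only \<open>a''\<close> is integrable at 0.\<close>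

lemma u''_le:
  assumes "0 < t"
  shows "\<bar>u'' t \<xi>\<bar> \<le> t * exp (- (t * a \<xi>)) *
    (\<bar>a'' \<xi>\<bar> + \<bar>b'' \<xi>\<bar> * \<bar>sin (t * b \<xi>)\<bar> + t * (\<bar>a' \<xi>\<bar> + \<bar>b' \<xi>\<bar>)\<^sup>2)"
proof -
  let ?s = "sin (t * b \<xi>)" and ?c = "cos (t * b \<xi>)"
  let ?p = "t * a' \<xi> * (a' \<xi> * ?c + b' \<xi> * ?s)"
  let ?q = "?p - (a'' \<xi> * ?c - t * a' \<xi> * b' \<xi> * ?s + b'' \<xi> * ?s + t * (b' \<xi>)\<^sup>2 * ?c)"
  have "\<bar>?p\<bar> = (t * \<bar>a' \<xi>\<bar>) * \<bar>a' \<xi> * ?c + b' \<xi> * ?s\<bar>" using assms by (simp add: abs_mult)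
  also have "\<dots> \<le> (t * \<bar>a' \<xi>\<bar>) * (\<bar>a' \<xi>\<bar> + \<bar>b' \<xi>\<bar>)"
    using assms by (intro mult_left_mono trig_comb_le) simp
  finally have p: "\<bar>?p\<bar> \<le> (t * \<bar>a' \<xi>\<bar>) * (\<bar>a' \<xi>\<bar> + \<bar>b' \<xi>\<bar>)" .
  have t1: "\<bar>a'' \<xi> * ?c\<bar> \<le> \<bar>a'' \<xi>\<bar>" by (rule abs_mult_trig_le)
  have t2: "\<bar>t * a' \<xi> * b' \<xi> * ?s\<bar> \<le> \<bar>t * a' \<xi> * b' \<xi>\<bar>" by (rule abs_mult_trig_le)
  have t3: "\<bar>t * (b' \<xi>)\<^sup>2 * ?c\<bar> \<le> \<bar>t * (b' \<xi>)\<^sup>2\<bar>" by (rule abs_mult_trig_le)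
  have t4: "\<bar>b'' \<xi> * ?s\<bar> = \<bar>b'' \<xi>\<bar> * \<bar>?s\<bar>" by (rule abs_mult)
  have sq: "(t * \<bar>a' \<xi>\<bar>) * (\<bar>a' \<xi>\<bar> + \<bar>b' \<xi>\<bar>) + \<bar>t * a' \<xi> * b' \<xi>\<bar> + \<bar>t * (b' \<xi>)\<^sup>2\<bar> = t * (\<bar>a' \<xi>\<bar> + \<bar>b' \<xi>\<bar>)\<^sup>2"
    using assms by (simp add: abs_mult power2_eq_square algebra_simps)
  have q: "\<bar>?q\<bar> \<le> \<bar>a'' \<xi>\<bar> + \<bar>b'' \<xi>\<bar> * \<bar>?s\<bar> + t * (\<bar>a' \<xi>\<bar> + \<bar>b' \<xi>\<bar>)\<^sup>2"
  proof -
    have "\<bar>?q\<bar> \<le> (t * \<bar>a' \<xi>\<bar>) * (\<bar>a' \<xi>\<bar> + \<bar>b' \<xi>\<bar>) + \<bar>a'' \<xi>\<bar> + \<bar>t * a' \<xi> * b' \<xi>\<bar>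
        + \<bar>b'' \<xi>\<bar> * \<bar>?s\<bar> + \<bar>t * (b' \<xi>)\<^sup>2\<bar>"
      by (rule abs_diff_sum_le[OF p t1 t2 eq_refl[OF t4] t3])
    also have "\<dots> = \<bar>a'' \<xi>\<bar> + \<bar>b'' \<xi>\<bar> * \<bar>?s\<bar> + t * (\<bar>a' \<xi>\<bar> + \<bar>b' \<xi>\<bar>)\<^sup>2"
      unfolding sq[symmetric] by (simp only: ac_simps)
    finally show ?thesis .
  qed
  have "\<bar>u'' t \<xi>\<bar> = t * exp (- (t * a \<xi>)) * \<bar>?q\<bar>"
    unfolding u''_def abs_mult[of "t * exp (- (t * a \<xi>))"] using assms by (simp only: abs_mult[of t] abs_exp_cancel abs_of_pos)
  also have "\<dots> \<le> t * exp (- (t * a \<xi>)) * (\<bar>a'' \<xi>\<bar> + \<bar>b'' \<xi>\<bar> * \<bar>?s\<bar> + t * (\<bar>a' \<xi>\<bar> + \<bar>b' \<xi>\<bar>)\<^sup>2)"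
    using assms by (intro mult_left_mono q) simp
  finally show ?thesis .
qed

lemma damping_le:
  assumes "0 < t" "0 < \<xi>"
  shows "exp (- (t * a \<xi>)) \<le> exp (- (\<alpha> * t * slog n \<xi> powr \<epsilon>))" "exp (- (t * a \<xi>)) \<le> 1"
proof -
  have "t * (\<alpha> * slog n \<xi> powr \<epsilon>) \<le> t * a \<xi>" using a_ge assms by (intro mult_left_mono) auto
  then show 1: "exp (- (t * a \<xi>)) \<le> exp (- (\<alpha> * t * slog n \<xi> powr \<epsilon>))" by (simp add: mult_ac)
  also have "\<dots> \<le> 1" using assms pos by simp
  finally show "exp (- (t * a \<xi>)) \<le> 1" .
qed

lemma u'_low:
  assumes "0 < t" "0 < \<xi>" "\<xi> \<le> 1"
  shows "\<bar>u' t \<xi>\<bar> \<le> 2 * c * t * \<xi> powr (\<epsilon> - 1)"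
proof -
  have "\<bar>u' t \<xi>\<bar> \<le> t * 1 * (2 * c * \<xi> powr (\<epsilon> - 1))"
    using assms by (intro order_trans[OF u'_le] mult_mono d1_low damping_le) auto
  then show ?thesis by (simp add: mult_ac)
qed

lemma u'_high:
  assumes "0 < t" "1 \<le> \<xi>"
  shows "\<bar>u' t \<xi>\<bar> \<le> 2 * c * t * damped_weight n \<epsilon> (\<alpha> * t) \<xi> / (1 + \<xi>)"
proof -
  have "\<bar>u' t \<xi>\<bar> \<le> t * exp (- (\<alpha> * t * slog n \<xi> powr \<epsilon>)) * (2 * c * (log_weight n \<epsilon> \<xi> / (1 + \<xi>)))"
    using assms by (intro order_trans[OF u'_le] mult_mono d1_high damping_le) auto
  then show ?thesis by (simp add: mult_ac damped_weight_def)
qed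

lemma u''_coarse:
  assumes "0 < t"
  shows "\<bar>u'' t \<xi>\<bar> \<le> t * exp (- (t * a \<xi>)) * ((\<bar>a'' \<xi>\<bar> + \<bar>b'' \<xi>\<bar>) + t * (\<bar>a' \<xi>\<bar> + \<bar>b' \<xi>\<bar>)\<^sup>2)"
proof -
  have "\<bar>b'' \<xi>\<bar> * \<bar>sin (t * b \<xi>)\<bar> \<le> \<bar>b'' \<xi>\<bar>" by (intro mult_right_le_one_le) auto
  then show ?thesis using assms by (intro order_trans[OF u''_le] mult_left_mono) auto
qed

text \<open>A constant in the bounds on \<open>u'' / t\<close> that is uniform for \<open>t \<le> \<tau>\<close>.\<close>

definition C2 :: "real \<Rightarrow> real" where
  "C2 \<tau> = 2 * c + 4 * c\<^sup>2 * \<tau> * (1 + log_weight n \<epsilon> 1)"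

lemma log_weight_1_pos: "0 < log_weight n \<epsilon> 1" by (rule log_weight_pos) simp

lemma C2_pos: "0 < \<tau> \<Longrightarrow> 0 < C2 \<tau>"
  unfolding C2_def using pos log_weight_1_pos by (intro add_pos_pos mult_pos_pos) auto

lemma u''_low:
  assumes t: "0 < t" "t \<le> \<tau>" and \<xi>: "0 < \<xi>" "\<xi> \<le> 1"
  shows "\<bar>u'' t \<xi>\<bar> \<le> C2 \<tau> * t * \<xi> powr (\<epsilon> - 2)"
proof -
  have "(\<bar>a' \<xi>\<bar> + \<bar>b' \<xi>\<bar>)\<^sup>2 \<le> (2 * c * \<xi> powr (\<epsilon> - 1))\<^sup>2"
    using d1_low[OF \<xi>] by (intro power_mono) auto
  also have "\<dots> = 4 * c\<^sup>2 * \<xi> powr (2 * \<epsilon> - 2)"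
    by (simp add: power2_eq_square powr_add[symmetric])
  also have "\<dots> \<le> 4 * c\<^sup>2 * \<xi> powr (\<epsilon> - 2)"
    using \<xi> eps by (intro mult_left_mono powr_mono') auto
  finally have s: "t * (\<bar>a' \<xi>\<bar> + \<bar>b' \<xi>\<bar>)\<^sup>2 \<le> \<tau> * (4 * c\<^sup>2 * \<xi> powr (\<epsilon> - 2))"
    using t by (intro mult_mono) auto
  have "0 \<le> 4 * c\<^sup>2 * \<tau> * log_weight n \<epsilon> 1 * \<xi> powr (\<epsilon> - 2)" using t log_weight_1_pos by auto
  then have "(\<bar>a'' \<xi>\<bar> + \<bar>b'' \<xi>\<bar>) + t * (\<bar>a' \<xi>\<bar> + \<bar>b' \<xi>\<bar>)\<^sup>2 \<le> C2 \<tau> * \<xi> powr (\<epsilon> - 2)"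
    using s d2_low[OF \<xi>] by (simp add: C2_def algebra_simps)
  then have "\<bar>u'' t \<xi>\<bar> \<le> t * 1 * (C2 \<tau> * \<xi> powr (\<epsilon> - 2))"
    using t \<xi> by (intro order_trans[OF u''_coarse] mult_mono damping_le) auto
  then show ?thesis by (simp add: mult_ac)
qed

lemma u''_high:
  assumes t: "0 < t" "t \<le> \<tau>" and \<xi>: "1 \<le> \<xi>"
  shows "\<bar>u'' t \<xi>\<bar> \<le> C2 \<tau> * t * damped_weight n \<epsilon> (\<alpha> * t) \<xi> / \<xi>\<^sup>2"
proof -
  let ?w = "log_weight n \<epsilon> \<xi>"
  have w: "0 < ?w" "?w \<le> log_weight n \<epsilon> 1"
    using \<xi> eps by (auto intro: log_weight_pos log_weight_antimono)
  have "(\<bar>a' \<xi>\<bar> + \<bar>b' \<xi>\<bar>)\<^sup>2 \<le> (2 * c * (?w / (1 + \<xi>)))\<^sup>2"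
    using d1_high[OF \<xi>] by (intro power_mono) auto
  also have "\<dots> = 4 * c\<^sup>2 * ?w * (?w / (1 + \<xi>)\<^sup>2)"
    by (simp add: power2_eq_square)
  also have "\<dots> \<le> 4 * c\<^sup>2 * (1 + log_weight n \<epsilon> 1) * (?w / (1 + \<xi>)\<^sup>2)"
    using w by (intro mult_right_mono mult_left_mono) auto
  finally have s: "t * (\<bar>a' \<xi>\<bar> + \<bar>b' \<xi>\<bar>)\<^sup>2 \<le> \<tau> * (4 * c\<^sup>2 * (1 + log_weight n \<epsilon> 1) * (?w / (1 + \<xi>)\<^sup>2))"
    using t by (intro mult_mono) auto
  then have "(\<bar>a'' \<xi>\<bar> + \<bar>b'' \<xi>\<bar>) + t * (\<bar>a' \<xi>\<bar> + \<bar>b' \<xi>\<bar>)\<^sup>2 \<le> C2 \<tau> * (?w / (1 + \<xi>)\<^sup>2)"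
    using d2_high[OF \<xi>] by (simp add: C2_def algebra_simps add_divide_distrib)
  also have "\<dots> \<le> C2 \<tau> * (?w / \<xi>\<^sup>2)"
    using \<xi> w t C2_pos[of \<tau>] by (intro mult_left_mono divide_left_mono power_mono) auto
  finally have "\<bar>u'' t \<xi>\<bar> \<le> t * exp (- (\<alpha> * t * slog n \<xi> powr \<epsilon>)) * (C2 \<tau> * (?w / \<xi>\<^sup>2))"
    using t \<xi> by (intro order_trans[OF u''_coarse] mult_mono damping_le) auto
  then show ?thesis by (simp add: damped_weight_def mult_ac)
qed

lemma u''_int: "0 < R \<Longrightarrow> (\<lambda>\<xi>. \<bar>u'' t \<xi>\<bar>) integrable_on {R..T}"
  by (intro integrable_continuous_real continuous_intros continuous_on_subset[OF cont_u'']) auto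

lemma integral_u''_high:
  assumes t: "0 < t" "t \<le> \<tau>" and R: "1 \<le> R" "R \<le> T"
  shows "integral {R..T} (\<lambda>\<xi>. \<bar>u'' t \<xi>\<bar>) \<le> C2 \<tau> * t * damped_weight n \<epsilon> (\<alpha> * t) R / R"
proof -
  let ?A = "C2 \<tau> * t * damped_weight n \<epsilon> (\<alpha> * t) R"
  have A: "0 \<le> ?A" using C2_pos[of \<tau>] t R damped_weight_pos[of R n \<epsilon> "\<alpha> * t"] by auto
  have h: "((\<lambda>\<xi>. ?A / \<xi>\<^sup>2) has_integral (- ?A / T - (- ?A / R))) {R..T}"
    by (rule fundamental_theorem_of_calculus[OF R(2)])
       (use R in \<open>auto intro!: derivative_eq_intros simp: power2_eq_square simp flip: has_real_derivative_iff_has_vector_derivative\<close>)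
  have "integral {R..T} (\<lambda>\<xi>. \<bar>u'' t \<xi>\<bar>) \<le> - ?A / T - (- ?A / R)"
  proof (rule has_integral_le[OF integrable_integral[OF u''_int] h])
    show "0 < R" using R by simp
    fix \<xi> assume \<xi>: "\<xi> \<in> {R..T}"
    have "C2 \<tau> * t * damped_weight n \<epsilon> (\<alpha> * t) \<xi> \<le> ?A"
      using \<xi> R t pos eps C2_pos[of \<tau>] by (intro mult_left_mono damped_weight_antimono) auto
    then show "\<bar>u'' t \<xi>\<bar> \<le> ?A / \<xi>\<^sup>2"
      using \<xi> R t by (intro order_trans[OF u''_high[OF t]] divide_right_mono) auto
  qed
  also have "\<dots> \<le> ?A / R" using A R by simp
  finally show ?thesis .
qed

text \<open>In the estimates of the cosine transform the constant \<open>K\<close> is uniform for \<open>t \<le> \<tau>\<close>, and the last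
  summand tends to 0 as \<open>T \<rightarrow> \<infinity>\<close>.\<close>

lemma cosine_transform_small_x:
  assumes \<tau>: "0 < \<tau>"
  obtains K where "0 < K" and "\<And>t x T. 0 < t \<Longrightarrow> t \<le> \<tau> \<Longrightarrow> 0 < x \<Longrightarrow> x \<le> 1 \<Longrightarrow> 1 / x \<le> T \<Longrightarrow>
     continuous_on {0..T} (u t) \<Longrightarrow>
     \<bar>integral {0..T} (\<lambda>\<xi>. cos (x * \<xi>) * u t \<xi>)\<bar>
       \<le> K * t * (1 / x * damped_weight n \<epsilon> (\<alpha> * t) (1 / x)) + (\<bar>u t T\<bar> / x + \<bar>u' t T\<bar> / x\<^sup>2)"
proof -
  have at0: "0 \<le> \<alpha> * \<tau>" using \<tau> pos by simp
  obtain K0 where K0: "0 < K0" "\<And>p \<xi> \<zeta>. 0 \<le> p \<Longrightarrow> p \<le> \<alpha> * \<tau> \<Longrightarrow> 1 \<le> \<xi> \<Longrightarrow> \<xi> \<le> \<zeta> \<Longrightarrow>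
       damped_weight n \<epsilon> p \<xi> \<le> K0 * sqrt (\<zeta> / \<xi>) * damped_weight n \<epsilon> p \<zeta>"
    by (rule damped_weight_slowly_varying[OF n eps at0], rule that; assumption)
  define \<omega> where "\<omega> = damped_weight n \<epsilon> (\<alpha> * \<tau>) 1"
  have \<omega>: "0 < \<omega>" by (simp add: \<omega>_def damped_weight_pos)
  define K1 where "K1 = 2 * c * K0 * (1 + 1 / \<omega>)"
  have K1: "0 < K1" using pos K0 \<omega> by (simp add: K1_def add_pos_pos)
  show ?thesis
  proof
    show "0 < 3 * K1 + C2 \<tau>" using K1 C2_pos[OF \<tau>] by simp
    fix t x T :: real
    assume t: "0 < t" "t \<le> \<tau>" and x: "0 < x" "x \<le> 1" and T: "1 / x \<le> T" and cu: "continuous_on {0..T} (u t)"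
    let ?W = "damped_weight n \<epsilon> (\<alpha> * t)"
    define R where "R = 1 / x"
    have R: "1 \<le> R" "R \<le> T" using x T by (auto simp: R_def)
    have W: "0 < ?W R" using R by (intro damped_weight_pos) auto
    have at: "0 \<le> \<alpha> * t" "\<alpha> * t \<le> \<alpha> * \<tau>" using t pos by auto
    have \<omega>_le: "\<omega> \<le> ?W 1"
      unfolding \<omega>_def damped_weight_def using at log_weight_1_pos by (intro mult_right_mono) (auto intro: mult_right_mono)
    \<comment> \<open>the summand 1 of \<open>1 + 1/\<omega>\<close> serves for \<open>\<xi> \<ge> 1\<close>, the summand \<open>1/\<omega>\<close> for \<open>\<xi> < 1\<close>\<close>
    define A where "A = K1 * t * ?W R"
    have K1_ge: "2 * c * K0 * 1 * (t * ?W R * sqrt (R / \<xi>)) \<le> K1 * (t * ?W R * sqrt (R / \<xi>))"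
        "2 * c * K0 * (1 / \<omega>) * (t * ?W R * sqrt (R / \<xi>)) \<le> K1 * (t * ?W R * sqrt (R / \<xi>))"
      if "0 < \<xi>" for \<xi>
    proof -
      have "0 \<le> t * ?W R * sqrt (R / \<xi>)" using t W R that by simp
      note nn = this
      have "2 * c * K0 * 1 \<le> K1" "2 * c * K0 * (1 / \<omega>) \<le> K1"
        unfolding K1_def using K0(1) \<omega> pos by (intro mult_left_mono; simp)+
      from mult_right_mono[OF this(1) nn] mult_right_mono[OF this(2) nn]
      show "2 * c * K0 * 1 * (t * ?W R * sqrt (R / \<xi>)) \<le> K1 * (t * ?W R * sqrt (R / \<xi>))"
        "2 * c * K0 * (1 / \<omega>) * (t * ?W R * sqrt (R / \<xi>)) \<le> K1 * (t * ?W R * sqrt (R / \<xi>))" .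
    qed
    have low: "\<xi> * \<bar>u' t \<xi>\<bar> \<le> A * sqrt (1 / x / \<xi>)" if \<xi>: "0 < \<xi>" "\<xi> \<le> 1 / x" for \<xi>
    proof (cases "1 \<le> \<xi>")
      case True
      have "\<xi> * \<bar>u' t \<xi>\<bar> \<le> \<xi> * (2 * c * t * ?W \<xi> / (1 + \<xi>))"
        by (rule mult_left_mono[OF u'_high[OF t(1) True]]) (use True in simp)
      also have "\<dots> = (\<xi> / (1 + \<xi>)) * (2 * c * t * ?W \<xi>)" by simp
      also have "\<dots> \<le> 1 * (2 * c * t * ?W \<xi>)"
        using True t pos damped_weight_pos[of \<xi> n \<epsilon> "\<alpha> * t"] by (intro mult_right_mono mult_nonneg_nonneg) auto
      also have "\<dots> \<le> 2 * c * t * (K0 * sqrt (R / \<xi>) * ?W R)"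
        unfolding mult_1
        using \<xi> t pos by (intro mult_left_mono K0(2)[OF at True]) (auto simp: R_def)
      also have "\<dots> = 2 * c * K0 * 1 * (t * ?W R * sqrt (R / \<xi>))" by (simp only: mult_ac mult_1)
      also have "\<dots> \<le> K1 * (t * ?W R * sqrt (R / \<xi>))" by (rule K1_ge(1)[OF \<xi>(1)])
      finally show ?thesis by (simp only: A_def R_def[symmetric] mult_ac)
    next
      case False
      have "\<omega> \<le> K0 * sqrt (R / 1) * ?W R"
        by (rule order_trans[OF \<omega>_le K0(2)[OF at order_refl R(1)]])
      also have "\<dots> \<le> K0 * sqrt (R / \<xi>) * ?W R"
      proof -
        have "sqrt (R / 1) \<le> sqrt (R / \<xi>)"
          using False \<xi>(1) R(1) by (intro real_sqrt_le_mono divide_left_mono) auto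
        then show ?thesis using W K0(1) by (intro mult_right_mono mult_left_mono) auto
      qed
      finally have one: "1 \<le> K0 * (1 / \<omega>) * (?W R * sqrt (R / \<xi>))"
        using \<omega> by (simp add: pos_le_divide_eq mult_ac)
      have "\<xi> * \<bar>u' t \<xi>\<bar> \<le> \<xi> * (2 * c * t * \<xi> powr (\<epsilon> - 1))"
        using False \<xi> t by (intro mult_left_mono u'_low) auto
      also have "\<dots> = 2 * c * t * \<xi> powr \<epsilon>" using \<xi> by (simp add: powr_mult_base mult_ac)
      also have "\<dots> \<le> 2 * c * t * 1"
        using False \<xi> t pos eps by (intro mult_left_mono powr_le1) auto
      also have "\<dots> \<le> 2 * c * t * (K0 * (1 / \<omega>) * (?W R * sqrt (R / \<xi>)))"
        using t pos by (intro mult_left_mono one) auto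
      also have "\<dots> = 2 * c * K0 * (1 / \<omega>) * (t * ?W R * sqrt (R / \<xi>))" by (simp only: mult_ac)
      also have "\<dots> \<le> K1 * (t * ?W R * sqrt (R / \<xi>))" by (rule K1_ge(2)[OF \<xi>(1)])
      finally show ?thesis by (simp only: A_def R_def[symmetric] mult_ac)
    qed
    have high: "integral {1 / x..T} (\<lambda>\<xi>. \<bar>u'' t \<xi>\<bar>) \<le> C2 \<tau> * t * ?W R * x"
      using integral_u''_high[OF t R] by (simp add: R_def)
    have "\<bar>integral {0..T} (\<lambda>\<xi>. cos (x * \<xi>) * u t \<xi>)\<bar>
        \<le> 3 * A / x + C2 \<tau> * t * ?W R * x / x\<^sup>2 + (\<bar>u t T\<bar> / x + \<bar>u' t T\<bar> / x\<^sup>2)"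
      by (rule oscillatory_integral_bound[OF x(1) T cu der_u der_u' cont_u'' low high])
    also have "3 * A / x + C2 \<tau> * t * ?W R * x / x\<^sup>2 = (3 * K1 + C2 \<tau>) * t * (1 / x * ?W (1 / x))"
      using x by (simp add: A_def R_def power2_eq_square distrib_right add_divide_distrib)
    finally show "\<bar>integral {0..T} (\<lambda>\<xi>. cos (x * \<xi>) * u t \<xi>)\<bar>
       \<le> (3 * K1 + C2 \<tau>) * t * (1 / x * ?W (1 / x)) + (\<bar>u t T\<bar> / x + \<bar>u' t T\<bar> / x\<^sup>2)" .
  qed
qed

lemma powr_le_tail_decay:
  assumes "1 \<le> x"
  shows "x powr (- 1 - \<epsilon>) \<le> 2 * tail_decay \<epsilon> Q x"
proof (cases "\<epsilon> < 1 \<or> Q")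
  case True
  then show ?thesis using eps by (cases "\<epsilon> < 1") (auto simp: tail_decay_def)
next
  case False
  have "1 / 2 \<le> ln (2 :: real)" using ln2_ge_two_thirds by simp
  also have "\<dots> \<le> ln (1 + x)" using assms by simp
  finally have "x powr (- 2) * 1 \<le> x powr (- 2) * (2 * ln (1 + x))"
    by (intro mult_left_mono) auto
  then show ?thesis using False eps by (simp add: tail_decay_def mult_ac)
qed

lemma cosine_transform_large_x_aux:
  assumes t: "0 < t" "t \<le> \<tau>" and x: "1 \<le> x" and T: "1 \<le> T"
    and cu: "continuous_on {0..T} (u t)"
    and B: "integral {1 / x..1} (\<lambda>\<xi>. \<bar>u'' t \<xi>\<bar>) \<le> B"
  shows "\<bar>integral {0..T} (\<lambda>\<xi>. cos (x * \<xi>) * u t \<xi>)\<bar>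
    \<le> 6 * c * t * x powr (- 1 - \<epsilon>) + (B + C2 \<tau> * t * log_weight n \<epsilon> 1) / x\<^sup>2
       + (\<bar>u t T\<bar> / x + \<bar>u' t T\<bar> / x\<^sup>2)"
proof -
  define R where "R = 1 / x"
  have R: "0 < R" "R \<le> 1" using x by (auto simp: R_def)
  define A where "A = 2 * c * t * R powr \<epsilon>"
  have A: "0 \<le> A" using pos t by (simp add: A_def)
  have low: "\<xi> * \<bar>u' t \<xi>\<bar> \<le> A * sqrt (1 / x / \<xi>)" if \<xi>: "0 < \<xi>" "\<xi> \<le> 1 / x" for \<xi>
  proof -
    have \<xi>1: "\<xi> \<le> 1" using \<xi> R unfolding R_def by linarith
    have "\<xi> * \<bar>u' t \<xi>\<bar> \<le> \<xi> * (2 * c * t * \<xi> powr (\<epsilon> - 1))"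
      by (rule mult_left_mono[OF u'_low[OF t(1) \<xi>(1) \<xi>1]]) (use \<xi> in simp)
    also have "\<dots> = 2 * c * t * \<xi> powr \<epsilon>" using \<xi> by (simp add: powr_mult_base mult.left_commute)
    also have "\<dots> \<le> A"
      unfolding A_def using \<xi> t pos eps by (intro mult_left_mono powr_mono2) (auto simp: R_def)
    also have "A = A * sqrt 1" by simp
    also have "\<dots> \<le> A * sqrt (1 / x / \<xi>)"
      by (intro mult_left_mono real_sqrt_le_mono iffD2[OF le_divide_eq_1_pos] \<xi> A)
    finally show ?thesis .
  qed
  have "integral {1 / x..1} (\<lambda>\<xi>. \<bar>u'' t \<xi>\<bar>) + integral {1..T} (\<lambda>\<xi>. \<bar>u'' t \<xi>\<bar>) = integral {1 / x..T} (\<lambda>\<xi>. \<bar>u'' t \<xi>\<bar>)"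
    by (rule Henstock_Kurzweil_Integration.integral_combine) (use R T in \<open>auto simp: R_def intro: u''_int\<close>)
  moreover have "integral {1..T} (\<lambda>\<xi>. \<bar>u'' t \<xi>\<bar>) \<le> C2 \<tau> * t * log_weight n \<epsilon> 1"
  proof -
    have "damped_weight n \<epsilon> (\<alpha> * t) 1 \<le> 1 * log_weight n \<epsilon> 1"
      unfolding damped_weight_def using pos t log_weight_1_pos by (intro mult_right_mono) auto
    then have "C2 \<tau> * t * damped_weight n \<epsilon> (\<alpha> * t) 1 \<le> C2 \<tau> * t * log_weight n \<epsilon> 1"
      using C2_pos[of \<tau>] t by (intro mult_left_mono) auto
    then show ?thesis using integral_u''_high[OF t order_refl T] by simp
  qed
  ultimately have high: "integral {1 / x..T} (\<lambda>\<xi>. \<bar>u'' t \<xi>\<bar>) \<le> B + C2 \<tau> * t * log_weight n \<epsilon> 1"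
    using B by linarith
  have x0: "0 < x" using x by simp
  have RT: "1 / x \<le> T" by (rule order_trans[OF R(2)[unfolded R_def] T])
  have "3 * A / x = 6 * c * t * (R powr \<epsilon> / x)" by (simp add: A_def)
  also have "R powr \<epsilon> / x = x powr (- 1 - \<epsilon>)"
  proof -
    have "R powr \<epsilon> = x powr (- \<epsilon>)" using x by (simp add: R_def powr_divide powr_minus_divide)
    then have "R powr \<epsilon> / x = x powr (- \<epsilon>) * x powr (- 1)"
      using x by (simp add: powr_minus_divide)
    also have "\<dots> = x powr (- \<epsilon> + - 1)" by (rule powr_add[symmetric])
    also have "- \<epsilon> + - 1 = - 1 - \<epsilon>" by simp
    finally show ?thesis .
  qed
  finally have A_eq: "3 * A / x = 6 * c * t * x powr (- 1 - \<epsilon>)" .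
  show ?thesis
    using oscillatory_integral_bound[OF x0 RT cu der_u der_u' cont_u'' low high] unfolding A_eq .
qed

text \<open>The range \<open>[1/x, 1]\<close> decides about the decay for large \<open>x\<close>: the bound \<open>\<xi>\<^bsup>\<epsilon>-2\<^esup>\<close> on \<open>u''\<close>
  produces the logarithm when \<open>\<epsilon> = 1\<close>.\<close>

lemma integral_u''_low:
  assumes \<tau>: "0 < \<tau>" and Q: "\<epsilon> = 1 \<Longrightarrow> Q \<Longrightarrow> (\<lambda>\<xi>. \<bar>a'' \<xi>\<bar>) integrable_on {0..1}"
  obtains K where "0 < K" and "\<And>t x. 0 < t \<Longrightarrow> t \<le> \<tau> \<Longrightarrow> 1 \<le> x \<Longrightarrow>
    integral {1 / x..1} (\<lambda>\<xi>. \<bar>u'' t \<xi>\<bar>) / x\<^sup>2 \<le> K * t * tail_decay \<epsilon> Q x"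
proof -
  have x2: "x powr (- 2) = 1 / x\<^sup>2" if "1 \<le> x" for x :: real
    using that by (simp add: powr_minus_divide powr_numeral)
  consider "\<epsilon> < 1" | "\<epsilon> = 1" "Q" | "\<epsilon> = 1" "\<not> Q" using eps by linarith
  then show ?thesis
  proof cases
    case 1
    show ?thesis
    proof
      show "0 < C2 \<tau> / (1 - \<epsilon>)" using 1 C2_pos[OF \<tau>] by simp
      fix t x :: real assume t: "0 < t" "t \<le> \<tau>" and x: "1 \<le> x"
      have R: "0 < 1 / x" "1 / x \<le> 1" using x by auto
      let ?A = "C2 \<tau> * t"
      have h: "((\<lambda>\<xi>. ?A * \<xi> powr (\<epsilon> - 2)) has_integral
          (?A * (1 powr (\<epsilon> - 1) / (\<epsilon> - 1)) - ?A * ((1 / x) powr (\<epsilon> - 1) / (\<epsilon> - 1)))) {1 / x..1}"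
      proof (rule fundamental_theorem_of_calculus[where f = "\<lambda>\<xi>. ?A * (\<xi> powr (\<epsilon> - 1) / (\<epsilon> - 1))", OF R(2)])
        fix \<xi> assume "\<xi> \<in> {1 / x..1}"
        then have "0 < \<xi>" using less_le_trans[OF R(1), of \<xi>] by auto
        then have "((\<lambda>\<xi>. \<xi> powr (\<epsilon> - 1)) has_real_derivative (\<epsilon> - 1) * \<xi> powr (\<epsilon> - 1 - 1)) (at \<xi>)"
          by (rule has_real_derivative_powr)
        from DERIV_cmult[OF DERIV_cdivide[OF this, of "\<epsilon> - 1"], of ?A]
        have "((\<lambda>\<xi>. ?A * (\<xi> powr (\<epsilon> - 1) / (\<epsilon> - 1))) has_real_derivative ?A * \<xi> powr (\<epsilon> - 2)) (at \<xi>)"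
          using 1 by (simp add: diff_diff_eq)
        then show "((\<lambda>\<xi>. ?A * (\<xi> powr (\<epsilon> - 1) / (\<epsilon> - 1))) has_vector_derivative ?A * \<xi> powr (\<epsilon> - 2)) (at \<xi> within {1 / x..1})"
          unfolding has_real_derivative_iff_has_vector_derivative by (rule has_vector_derivative_at_within)
      qed
      have "integral {1 / x..1} (\<lambda>\<xi>. \<bar>u'' t \<xi>\<bar>)
          \<le> ?A * (1 powr (\<epsilon> - 1) / (\<epsilon> - 1)) - ?A * ((1 / x) powr (\<epsilon> - 1) / (\<epsilon> - 1))"
      proof (rule has_integral_le[OF integrable_integral[OF u''_int[OF R(1)]] h])
        fix \<xi> assume "\<xi> \<in> {1 / x..1}"
        then have "0 < \<xi>" "\<xi> \<le> 1" using less_le_trans[OF R(1), of \<xi>] by auto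
        then show "\<bar>u'' t \<xi>\<bar> \<le> ?A * \<xi> powr (\<epsilon> - 2)" by (rule u''_low[OF t])
      qed
      also have "\<dots> = ?A / (1 - \<epsilon>) * ((1 / x) powr (\<epsilon> - 1) - 1)"
      proof -
        have "(1 - y) / (\<epsilon> - 1) = (y - 1) / (1 - \<epsilon>)" for y
          using minus_divide_divide[of "1 - y" "\<epsilon> - 1"] by simp
        then have "?A * (1 / (\<epsilon> - 1)) - ?A * (y / (\<epsilon> - 1)) = ?A / (1 - \<epsilon>) * (y - 1)" for y
          by (simp only: right_diff_distrib[symmetric] diff_divide_distrib[symmetric]) simp
        then show ?thesis by simp
      qed
      also have "\<dots> \<le> ?A / (1 - \<epsilon>) * (1 / x) powr (\<epsilon> - 1)"
        using 1 t C2_pos[OF \<tau>] by (intro mult_left_mono) auto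
      also have "(1 / x) powr (\<epsilon> - 1) = x powr (1 - \<epsilon>)"
      proof -
        have "(1 / x) powr (\<epsilon> - 1) = x powr (- (\<epsilon> - 1))"
          unfolding powr_minus_divide using x by (simp add: powr_divide)
        then show ?thesis by simp
      qed
      finally have I: "integral {1 / x..1} (\<lambda>\<xi>. \<bar>u'' t \<xi>\<bar>) \<le> ?A / (1 - \<epsilon>) * x powr (1 - \<epsilon>)" .
      have "integral {1 / x..1} (\<lambda>\<xi>. \<bar>u'' t \<xi>\<bar>) / x\<^sup>2 = integral {1 / x..1} (\<lambda>\<xi>. \<bar>u'' t \<xi>\<bar>) * x powr (- 2)"
        by (simp add: x2[OF x])
      also have "\<dots> \<le> ?A / (1 - \<epsilon>) * x powr (1 - \<epsilon>) * x powr (- 2)"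
        by (rule mult_right_mono[OF I]) simp
      also have "\<dots> = C2 \<tau> / (1 - \<epsilon>) * t * x powr (- 1 - \<epsilon>)"
        by (simp flip: powr_add)
      finally show "integral {1 / x..1} (\<lambda>\<xi>. \<bar>u'' t \<xi>\<bar>) / x\<^sup>2 \<le> C2 \<tau> / (1 - \<epsilon>) * t * tail_decay \<epsilon> Q x"
        using 1 by (simp add: tail_decay_def)
    qed
  next
    case 2
    define I where "I = integral {0..1} (\<lambda>\<xi>. \<bar>a'' \<xi>\<bar>)"
    have I: "0 \<le> I" unfolding I_def by (rule integral_nonneg[OF Q[OF 2]]) simp
    show ?thesis
    proof
      show K: "0 < I + 6 * c\<^sup>2 * \<tau>" using I pos \<tau> by (intro add_nonneg_pos) auto
      fix t x :: real assume t: "0 < t" "t \<le> \<tau>" and x: "1 \<le> x"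
      have R: "0 < 1 / x" "1 / x \<le> 1" using x by auto
      have int: "(\<lambda>\<xi>. \<bar>a'' \<xi>\<bar>) integrable_on {1 / x..1}"
        by (rule integrable_on_subinterval[OF Q[OF 2]]) (use R in auto)
      \<comment> \<open>\<open>b''\<close> need not be integrable near 0, but it only occurs multiplied by \<open>sin (t b)\<close>\<close>
      have bd: "\<bar>u'' t \<xi>\<bar> \<le> t * (\<bar>a'' \<xi>\<bar> + 6 * c\<^sup>2 * \<tau>)" if \<xi>: "\<xi> \<in> {1 / x..1}" for \<xi>
      proof -
        have \<xi>0: "0 < \<xi>" "\<xi> \<le> 1" using \<xi> R less_le_trans[OF R(1), of \<xi>] by auto
        have "\<bar>sin (t * b \<xi>)\<bar> \<le> \<bar>t * b \<xi>\<bar>" by (rule abs_sin_x_le_abs_x)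
        also have "\<dots> = t * \<bar>b \<xi>\<bar>" using t by (simp add: abs_mult)
        also have "\<dots> \<le> t * (c * \<xi>)"
          using b_le[OF \<xi>0] t 2 \<xi>0 by (intro mult_left_mono) auto
        finally have s: "\<bar>sin (t * b \<xi>)\<bar> \<le> t * (c * \<xi>)" .
        have "\<bar>b'' \<xi>\<bar> \<le> 2 * c * \<xi> powr (- 1)"
          using d2_low[OF \<xi>0] 2 by simp
        then have b2: "\<bar>b'' \<xi>\<bar> \<le> 2 * c / \<xi>" using \<xi>0 by (simp add: powr_minus_divide)
        have "\<bar>b'' \<xi>\<bar> * \<bar>sin (t * b \<xi>)\<bar> \<le> (2 * c / \<xi>) * (t * (c * \<xi>))"
          using b2 s pos \<xi>0 by (intro mult_mono) auto
        also have "\<dots> = 2 * c\<^sup>2 * t" using \<xi>0 by (simp add: power2_eq_square)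
        also have "\<dots> \<le> 2 * c\<^sup>2 * \<tau>" using t by (intro mult_left_mono) auto
        finally have p1: "\<bar>b'' \<xi>\<bar> * \<bar>sin (t * b \<xi>)\<bar> \<le> 2 * c\<^sup>2 * \<tau>" .
        have "(\<bar>a' \<xi>\<bar> + \<bar>b' \<xi>\<bar>)\<^sup>2 \<le> (2 * c)\<^sup>2"
          using d1_low[OF \<xi>0] 2 \<xi>0 by (intro power_mono) auto
        then have "t * (\<bar>a' \<xi>\<bar> + \<bar>b' \<xi>\<bar>)\<^sup>2 \<le> \<tau> * (2 * c)\<^sup>2"
          using t by (intro mult_mono) auto
        then have p2: "t * (\<bar>a' \<xi>\<bar> + \<bar>b' \<xi>\<bar>)\<^sup>2 \<le> 4 * c\<^sup>2 * \<tau>" by (simp add: power2_eq_square mult_ac)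
        have "\<bar>u'' t \<xi>\<bar> \<le> t * exp (- (t * a \<xi>)) *
            (\<bar>a'' \<xi>\<bar> + \<bar>b'' \<xi>\<bar> * \<bar>sin (t * b \<xi>)\<bar> + t * (\<bar>a' \<xi>\<bar> + \<bar>b' \<xi>\<bar>)\<^sup>2)"
          by (rule u''_le[OF t(1)])
        also have "\<dots> \<le> t * 1 * (\<bar>a'' \<xi>\<bar> + 6 * c\<^sup>2 * \<tau>)"
        proof (rule mult_mono)
          show "t * exp (- (t * a \<xi>)) \<le> t * 1"
            using damping_le(2)[OF t(1) \<xi>0(1)] t by (intro mult_left_mono) auto
          show "\<bar>a'' \<xi>\<bar> + \<bar>b'' \<xi>\<bar> * \<bar>sin (t * b \<xi>)\<bar> + t * (\<bar>a' \<xi>\<bar> + \<bar>b' \<xi>\<bar>)\<^sup>2 \<le> \<bar>a'' \<xi>\<bar> + 6 * c\<^sup>2 * \<tau>"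
            using p1 p2 by linarith
        qed (use t in auto)
        finally show ?thesis by simp
      qed
      have "integral {1 / x..1} (\<lambda>\<xi>. \<bar>u'' t \<xi>\<bar>) \<le> integral {1 / x..1} (\<lambda>\<xi>. t * (\<bar>a'' \<xi>\<bar> + 6 * c\<^sup>2 * \<tau>))"
        by (rule integral_le[OF u''_int[OF R(1)] _ bd]) (intro integrable_on_mult_right integrable_add int integrable_const_ivl)
      also have "\<dots> = t * integral {1 / x..1} (\<lambda>\<xi>. \<bar>a'' \<xi>\<bar> + 6 * c\<^sup>2 * \<tau>)" by (simp only: integral_mult_right)
      also have "integral {1 / x..1} (\<lambda>\<xi>. \<bar>a'' \<xi>\<bar> + 6 * c\<^sup>2 * \<tau>)
          = integral {1 / x..1} (\<lambda>\<xi>. \<bar>a'' \<xi>\<bar>) + integral {1 / x..1} (\<lambda>\<xi>. 6 * c\<^sup>2 * \<tau>)"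
        by (rule Henstock_Kurzweil_Integration.integral_add[OF int integrable_const_ivl])
      also have "\<dots> \<le> I + 6 * c\<^sup>2 * \<tau>"
      proof (rule add_mono)
        show "integral {1 / x..1} (\<lambda>\<xi>. \<bar>a'' \<xi>\<bar>) \<le> I"
          unfolding I_def by (rule integral_subset_le[OF _ int Q[OF 2]]) (use R in auto)
        have "(1 - 1 / x) * (6 * c\<^sup>2 * \<tau>) \<le> 1 * (6 * c\<^sup>2 * \<tau>)"
          using x \<tau> by (intro mult_right_mono) auto
        then show "integral {1 / x..1} (\<lambda>\<xi>. 6 * c\<^sup>2 * \<tau>) \<le> 6 * c\<^sup>2 * \<tau>"
          using R by (simp only: integral_const_real content_real real_scaleR_def) 
      qed
      finally have "integral {1 / x..1} (\<lambda>\<xi>. \<bar>u'' t \<xi>\<bar>) \<le> t * (I + 6 * c\<^sup>2 * \<tau>)" using t by simp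
      then have "integral {1 / x..1} (\<lambda>\<xi>. \<bar>u'' t \<xi>\<bar>) / x\<^sup>2 \<le> t * (I + 6 * c\<^sup>2 * \<tau>) / x\<^sup>2"
        by (rule divide_right_mono) simp
      then show "integral {1 / x..1} (\<lambda>\<xi>. \<bar>u'' t \<xi>\<bar>) / x\<^sup>2 \<le> (I + 6 * c\<^sup>2 * \<tau>) * t * tail_decay \<epsilon> Q x"
        using 2 by (simp add: tail_decay_def x2[OF x] mult.commute)
    qed
  next
    case 3
    show ?thesis
    proof
      show "0 < C2 \<tau>" by (rule C2_pos[OF \<tau>])
      fix t x :: real assume t: "0 < t" "t \<le> \<tau>" and x: "1 \<le> x"
      have R: "0 < 1 / x" "1 / x \<le> 1" using x by auto
      let ?A = "C2 \<tau> * t"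
      have h: "((\<lambda>\<xi>. ?A * (1 / \<xi>)) has_integral (?A * ln 1 - ?A * ln (1 / x))) {1 / x..1}"
      proof (rule fundamental_theorem_of_calculus[where f = "\<lambda>\<xi>. ?A * ln \<xi>", OF R(2)])
        fix \<xi> assume "\<xi> \<in> {1 / x..1}"
        then have "0 < \<xi>" using less_le_trans[OF R(1), of \<xi>] by auto
        from DERIV_cmult[OF DERIV_ln_divide[OF this], of ?A]
        show "((\<lambda>\<xi>. ?A * ln \<xi>) has_vector_derivative ?A * (1 / \<xi>)) (at \<xi> within {1 / x..1})"
          unfolding has_real_derivative_iff_has_vector_derivative by (rule has_vector_derivative_at_within)
      qed
      have "integral {1 / x..1} (\<lambda>\<xi>. \<bar>u'' t \<xi>\<bar>) \<le> ?A * ln 1 - ?A * ln (1 / x)"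
      proof (rule has_integral_le[OF integrable_integral[OF u''_int[OF R(1)]] h])
        fix \<xi> assume "\<xi> \<in> {1 / x..1}"
        then have \<xi>: "0 < \<xi>" "\<xi> \<le> 1" using less_le_trans[OF R(1), of \<xi>] by auto
        then show "\<bar>u'' t \<xi>\<bar> \<le> ?A * (1 / \<xi>)"
          using u''_low[OF t \<xi>] 3 by (simp add: powr_minus_divide)
      qed
      also have "\<dots> = ?A * ln x" using x by (simp add: ln_div)
      also have "\<dots> \<le> ?A * ln (1 + x)"
        using x t C2_pos[OF \<tau>] by (intro mult_left_mono) auto
      finally have "integral {1 / x..1} (\<lambda>\<xi>. \<bar>u'' t \<xi>\<bar>) / x\<^sup>2 \<le> ?A * ln (1 + x) / x\<^sup>2"
        by (rule divide_right_mono) simp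
      then show "integral {1 / x..1} (\<lambda>\<xi>. \<bar>u'' t \<xi>\<bar>) / x\<^sup>2 \<le> C2 \<tau> * t * tail_decay \<epsilon> Q x"
        using 3 by (simp add: tail_decay_def x2[OF x])
    qed
  qed
qed

lemma cosine_transform_large_x:
  assumes \<tau>: "0 < \<tau>" and Q: "\<epsilon> = 1 \<Longrightarrow> Q \<Longrightarrow> (\<lambda>\<xi>. \<bar>a'' \<xi>\<bar>) integrable_on {0..1}"
  obtains K where "0 < K" and "\<And>t x T. 0 < t \<Longrightarrow> t \<le> \<tau> \<Longrightarrow> 1 \<le> x \<Longrightarrow> 1 \<le> T \<Longrightarrow>
     continuous_on {0..T} (u t) \<Longrightarrow>
     \<bar>integral {0..T} (\<lambda>\<xi>. cos (x * \<xi>) * u t \<xi>)\<bar>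
       \<le> K * t * tail_decay \<epsilon> Q x + (\<bar>u t T\<bar> / x + \<bar>u' t T\<bar> / x\<^sup>2)"
proof (rule integral_u''_low[OF \<tau> Q])
  fix K assume K: "0 < K" and Kb: "\<And>t x. 0 < t \<Longrightarrow> t \<le> \<tau> \<Longrightarrow> 1 \<le> x \<Longrightarrow>
    integral {1 / x..1} (\<lambda>\<xi>. \<bar>u'' t \<xi>\<bar>) / x\<^sup>2 \<le> K * t * tail_decay \<epsilon> Q x"
  let ?L = "C2 \<tau> * log_weight n \<epsilon> 1"
  have L: "0 \<le> ?L" using C2_pos[OF \<tau>] log_weight_1_pos by simp
  show thesis
  proof (rule that)
    show "0 < 12 * c + K + 2 * ?L" using K L pos by linarith
    fix t x T :: real
    assume t: "0 < t" "t \<le> \<tau>" and x: "1 \<le> x" and T: "1 \<le> T" and cu: "continuous_on {0..T} (u t)"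
    let ?d = "tail_decay \<epsilon> Q x" and ?I = "integral {1 / x..1} (\<lambda>\<xi>. \<bar>u'' t \<xi>\<bar>)"
    let ?e = "\<bar>u t T\<bar> / x + \<bar>u' t T\<bar> / x\<^sup>2"
    have d: "x powr (- 1 - \<epsilon>) \<le> 2 * ?d" by (rule powr_le_tail_decay[OF x])
    have "1 / x\<^sup>2 = x powr (- 2)" using x by (simp add: powr_minus_divide powr_numeral)
    also have "\<dots> \<le> x powr (- 1 - \<epsilon>)" using x eps by (intro powr_mono) auto
    finally have d2: "1 / x\<^sup>2 \<le> 2 * ?d" using d by simp
    have "\<bar>integral {0..T} (\<lambda>\<xi>. cos (x * \<xi>) * u t \<xi>)\<bar>
        \<le> 6 * c * t * x powr (- 1 - \<epsilon>) + (?I + C2 \<tau> * t * log_weight n \<epsilon> 1) / x\<^sup>2 + ?e"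
      by (rule cosine_transform_large_x_aux[OF t x T cu order_refl])
    also have "(?I + C2 \<tau> * t * log_weight n \<epsilon> 1) / x\<^sup>2 = ?I / x\<^sup>2 + ?L * t * (1 / x\<^sup>2)"
      by (simp add: add_divide_distrib mult_ac)
    also have "6 * c * t * x powr (- 1 - \<epsilon>) + (?I / x\<^sup>2 + ?L * t * (1 / x\<^sup>2)) + ?e
        \<le> 6 * c * t * (2 * ?d) + (K * t * ?d + ?L * t * (2 * ?d)) + ?e"
      using t pos L by (intro add_mono mult_left_mono d d2 Kb[OF t x] order_refl) auto
    also have "\<dots> = (12 * c + K + 2 * ?L) * t * ?d + ?e" by (simp add: algebra_simps)
    finally show "\<bar>integral {0..T} (\<lambda>\<xi>. cos (x * \<xi>) * u t \<xi>)\<bar> \<le> (12 * c + K + 2 * ?L) * t * ?d + ?e" .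
  qed
qed

lemma cosine_transform_envelope:
  assumes \<tau>: "0 < \<tau>" and Q: "\<epsilon> = 1 \<Longrightarrow> Q \<Longrightarrow> (\<lambda>\<xi>. \<bar>a'' \<xi>\<bar>) integrable_on {0..1}"
  shows "\<exists>K>0. \<forall>t x T. 0 < t \<longrightarrow> t \<le> \<tau> \<longrightarrow> 0 < x \<longrightarrow> 1 \<le> T \<longrightarrow> 1 / x \<le> T \<longrightarrow>
     continuous_on {0..T} (u t) \<longrightarrow>
     \<bar>integral {0..T} (\<lambda>\<xi>. cos (x * \<xi>) * u t \<xi>)\<bar>
       \<le> K * t * envelope n \<epsilon> Q (\<alpha> * t) x + (\<bar>u t T\<bar> / x + \<bar>u' t T\<bar> / x\<^sup>2)"
proof (rule cosine_transform_small_x[OF \<tau>], rule cosine_transform_large_x[OF \<tau> Q])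
  fix K1 K2 assume K: "0 < K1" "0 < K2"
    and small: "\<And>t x T. 0 < t \<Longrightarrow> t \<le> \<tau> \<Longrightarrow> 0 < x \<Longrightarrow> x \<le> 1 \<Longrightarrow> 1 / x \<le> T \<Longrightarrow>
     continuous_on {0..T} (u t) \<Longrightarrow>
     \<bar>integral {0..T} (\<lambda>\<xi>. cos (x * \<xi>) * u t \<xi>)\<bar>
       \<le> K1 * t * (1 / x * damped_weight n \<epsilon> (\<alpha> * t) (1 / x)) + (\<bar>u t T\<bar> / x + \<bar>u' t T\<bar> / x\<^sup>2)"
    and large: "\<And>t x T. 0 < t \<Longrightarrow> t \<le> \<tau> \<Longrightarrow> 1 \<le> x \<Longrightarrow> 1 \<le> T \<Longrightarrow>
     continuous_on {0..T} (u t) \<Longrightarrow>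
     \<bar>integral {0..T} (\<lambda>\<xi>. cos (x * \<xi>) * u t \<xi>)\<bar>
       \<le> K2 * t * tail_decay \<epsilon> Q x + (\<bar>u t T\<bar> / x + \<bar>u' t T\<bar> / x\<^sup>2)"
  define \<omega> where "\<omega> = damped_weight n \<epsilon> (\<alpha> * \<tau>) 1"
  have \<omega>: "0 < \<omega>" by (simp add: \<omega>_def damped_weight_pos)
  show ?thesis
  proof (intro exI conjI allI impI)
    show "0 < 2 * K1 + K2 / \<omega>" using K \<omega> by (simp add: add_pos_pos)
    fix t x T :: real
    assume t: "0 < t" "t \<le> \<tau>" and x: "0 < x" and T: "1 \<le> T" "1 / x \<le> T" and cu: "continuous_on {0..T} (u t)"
    let ?E = "envelope n \<epsilon> Q (\<alpha> * t) x" and ?e = "\<bar>u t T\<bar> / x + \<bar>u' t T\<bar> / x\<^sup>2"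
    have E: "0 \<le> t * ?E" using envelope_nonneg[OF x] t by simp
    have "\<bar>integral {0..T} (\<lambda>\<xi>. cos (x * \<xi>) * u t \<xi>)\<bar> \<le> 2 * K1 * (t * ?E) + K2 / \<omega> * (t * ?E) + ?e"
    proof (cases "x \<le> 1")
      case True
      define S where "S = 1 / x * damped_weight n \<epsilon> (\<alpha> * t) (1 / x)"
      have S: "0 \<le> S" using x damped_weight_pos[of "1 / x" n \<epsilon> "\<alpha> * t"] by (simp add: S_def)
      have "?E = S * tail_decay \<epsilon> Q 1" using True x by (simp add: envelope_def S_def)
      moreover have "S * (1 / 2) \<le> S * tail_decay \<epsilon> Q 1" using S tail_decay_1 by (intro mult_left_mono) auto
      ultimately have "S \<le> 2 * ?E" by linarith
      then have "K1 * t * S \<le> K1 * t * (2 * ?E)" using K t by (intro mult_left_mono) auto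
      then have "K1 * t * S \<le> 2 * K1 * (t * ?E)" by (simp only: mult_ac)
      moreover have "0 \<le> K2 / \<omega> * (t * ?E)" using K \<omega> E by simp
      ultimately show ?thesis using small[OF t x True T(2) cu] unfolding S_def[symmetric] by linarith
    next
      case False
      then have x1: "1 \<le> x" by simp
      have "\<omega> \<le> damped_weight n \<epsilon> (\<alpha> * t) 1"
        unfolding \<omega>_def damped_weight_def using pos t log_weight_1_pos by (intro mult_right_mono) (auto intro: mult_right_mono)
      then have "\<omega> * tail_decay \<epsilon> Q x \<le> ?E"
        using x1 tail_decay_nonneg[OF x1] by (simp add: envelope_def mult_right_mono)
      then have "tail_decay \<epsilon> Q x \<le> ?E / \<omega>" using \<omega> by (simp add: pos_le_divide_eq mult.commute)
      then have "K2 * t * tail_decay \<epsilon> Q x \<le> K2 * t * (?E / \<omega>)" using K t by (intro mult_left_mono) auto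
      then have "K2 * t * tail_decay \<epsilon> Q x \<le> K2 / \<omega> * (t * ?E)" by simp
      moreover have "0 \<le> 2 * K1 * (t * ?E)" using K E by simp
      ultimately show ?thesis using large[OF t x1 T(1) cu] by linarith
    qed
    also have "2 * K1 * (t * ?E) + K2 / \<omega> * (t * ?E) = (2 * K1 + K2 / \<omega>) * t * ?E"
      by (simp only: distrib_right mult.assoc)
    finally show "\<bar>integral {0..T} (\<lambda>\<xi>. cos (x * \<xi>) * u t \<xi>)\<bar> \<le> (2 * K1 + K2 / \<omega>) * t * ?E + ?e" .
  qed
qed

lemma u_tendsto: "0 < t \<Longrightarrow> (u t \<longlongrightarrow> 0) at_top"
proof (rule Lim_null_comparison)
  assume t: "0 < t"
  show "eventually (\<lambda>\<xi>. norm (u t \<xi>) \<le> exp (- (\<alpha> * t * slog n \<xi> powr \<epsilon>))) at_top"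
    using eventually_gt_at_top[of 0]
    by eventually_elim (simp, rule order_trans[OF u_le damping_le(1)[OF t]])
  show "((\<lambda>\<xi>. exp (- (\<alpha> * t * slog n \<xi> powr \<epsilon>))) \<longlongrightarrow> 0) at_top"
    using damping_tendsto[of "\<alpha> * t" \<epsilon> n] t pos eps by simp
qed

lemma u'_tendsto: "0 < t \<Longrightarrow> (u' t \<longlongrightarrow> 0) at_top"
proof (rule Lim_null_comparison)
  assume t: "0 < t"
  let ?K = "2 * c * t * damped_weight n \<epsilon> (\<alpha> * t) 1"
  show "eventually (\<lambda>\<xi>. norm (u' t \<xi>) \<le> ?K / (1 + \<xi>)) at_top"
    using eventually_ge_at_top[of 1]
  proof eventually_elim
    case (elim \<xi>)
    have "2 * c * t * damped_weight n \<epsilon> (\<alpha> * t) \<xi> \<le> ?K"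
      using elim t pos eps by (intro mult_left_mono damped_weight_antimono) auto
    then have "2 * c * t * damped_weight n \<epsilon> (\<alpha> * t) \<xi> / (1 + \<xi>) \<le> ?K / (1 + \<xi>)"
      using elim by (intro divide_right_mono) auto
    then show ?case using u'_high[OF t elim] by simp
  qed
  show "((\<lambda>\<xi>. ?K / (1 + \<xi>)) \<longlongrightarrow> 0) at_top"
    by (intro real_tendsto_divide_at_top[OF tendsto_const] filterlim_tendsto_add_at_top[OF tendsto_const] filterlim_ident)
qed

end

section \<open>Transition densities\<close>

lemma C2_differentiable_on_component:
  fixes f :: "real \<Rightarrow> 'a::real_normed_vector" and h :: "'a \<Rightarrow> real"
  assumes f: "f C2_differentiable_on (UNIV - {0})" and h: "bounded_linear h"
    and g: "\<And>x. g x = h (f x)"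
  shows "x \<noteq> 0 \<Longrightarrow> (g has_real_derivative deriv g x) (at x)"
    and "x \<noteq> 0 \<Longrightarrow> (deriv g has_real_derivative deriv (deriv g) x) (at x)"
    and "continuous_on (- {0}) (deriv (deriv g))"
proof -
  let ?D = "\<lambda>x. vector_derivative f (at x)"
  obtain D1 where D1': "\<forall>x\<in>UNIV - {0}. (f has_vector_derivative D1 x) (at x)"
    using f unfolding C2_differentiable_on_def C1_differentiable_on_def by blast
  obtain D2 where D2': "\<forall>x\<in>UNIV - {0}. (?D has_vector_derivative D2 x) (at x)" "continuous_on (UNIV - {0}) D2"
    using f unfolding C2_differentiable_on_def C1_differentiable_on_def by blast
  have D1: "(f has_vector_derivative D1 x) (at x)" and D2: "(?D has_vector_derivative D2 x) (at x)"
    if "x \<noteq> 0" for x using D1' D2' that by simp_all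
  have D2_cont: "continuous_on (- {0}) D2" using D2'(2) by (simp only: Compl_eq_Diff_UNIV)
  have fD: "(f has_vector_derivative ?D x) (at x)" if "x \<noteq> 0" for x
    using D1[OF that] by (simp add: vector_derivative_at)
  have g_eq: "g = (\<lambda>x. h (f x))" using g by auto
  have g1: "(g has_real_derivative h (?D x)) (at x)" if "x \<noteq> 0" for x
    using bounded_linear.has_vector_derivative[OF h fD[OF that]]
    unfolding g_eq has_real_derivative_iff_has_vector_derivative .
  have dg: "deriv g x = h (?D x)" if "x \<noteq> 0" for x
    by (rule DERIV_imp_deriv[OF g1[OF that]])
  show "(g has_real_derivative deriv g x) (at x)" if "x \<noteq> 0" for x
    unfolding dg[OF that] by (rule g1[OF that])
  have g2: "(deriv g has_real_derivative h (D2 x)) (at x)" if "x \<noteq> 0" for x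
  proof (rule has_field_derivative_transform_within_open)
    show "((\<lambda>x. h (?D x)) has_real_derivative h (D2 x)) (at x)"
      using bounded_linear.has_vector_derivative[OF h D2[OF that]]
      unfolding has_real_derivative_iff_has_vector_derivative .
    show "open (- {0 :: real})" by (rule open_Compl) simp
    show "x \<in> - {0}" using that by simp
  qed (simp add: dg)
  have ddg: "deriv (deriv g) x = h (D2 x)" if "x \<noteq> 0" for x
    by (rule DERIV_imp_deriv[OF g2[OF that]])
  show "(deriv g has_real_derivative deriv (deriv g) x) (at x)" if "x \<noteq> 0" for x
    unfolding ddg[OF that] by (rule g2[OF that])
  have "continuous_on (- {0}) (\<lambda>x. h (D2 x))"
    by (rule bounded_linear.continuous_on[OF h D2_cont])
  then show "continuous_on (- {0}) (deriv (deriv g))"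
    by (rule continuous_on_eq) (simp add: ddg)
qed

lemma envelope_le_small:
  assumes "0 < x" "x \<le> 1"
  shows "envelope n \<epsilon> Q a x \<le> 1 / x * damped_weight n \<epsilon> a (1 / x)"
proof -
  have "1 / x * damped_weight n \<epsilon> a (1 / x) * tail_decay \<epsilon> Q 1 \<le> 1 / x * damped_weight n \<epsilon> a (1 / x) * 1"
    using assms damped_weight_pos[of "1 / x" n \<epsilon> a] by (intro mult_left_mono tail_decay_1) auto
  then show ?thesis using assms by (simp add: envelope_def)
qed

lemma envelope_le_large:
  assumes "1 \<le> x" "0 \<le> a"
  shows "envelope n \<epsilon> Q a x \<le> log_weight n \<epsilon> 1 * tail_decay \<epsilon> Q x"
proof -
  have "damped_weight n \<epsilon> a 1 \<le> 1 * log_weight n \<epsilon> 1"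
    unfolding damped_weight_def
    using assms log_weight_pos[of 1 n \<epsilon>] by (intro mult_right_mono) auto
  then show ?thesis
    using assms tail_decay_nonneg[of x \<epsilon> Q] by (simp add: envelope_def mult_right_mono)
qed

lemma tail_decay_le:
  assumes "1 \<le> x" "\<epsilon> \<le> 1"
  shows "tail_decay \<epsilon> Q x \<le> 2 * (if \<epsilon> < 1 then x powr (- 1 - \<epsilon>) else x powr (- 2) * ln (1 + x))"
proof (cases "\<epsilon> < 1")
  case False
  have "1 / 2 \<le> ln (2 :: real)" using ln2_ge_two_thirds by simp
  also have "\<dots> \<le> ln (1 + x)" using assms by simp
  finally have l: "1 \<le> 2 * ln (1 + x)" by simp
  have "x powr (- 2) * 1 \<le> x powr (- 2) * (2 * ln (1 + x))"
    by (rule mult_left_mono[OF l]) simp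
  moreover have "0 \<le> x powr (- 2) * ln (1 + x)" using assms by simp
  ultimately show ?thesis using False by (cases Q) (simp_all add: tail_decay_def mult_ac)
qed (simp add: tail_decay_def)

theorem theorem1p1:
  fixes M :: "'w measure" and X :: "real \<Rightarrow> 'w \<Rightarrow> real" and n :: nat
    and \<eta> :: "real \<Rightarrow> complex" and \<eta>1 \<eta>2 :: "real \<Rightarrow> real"
    and \<epsilon> \<alpha> c :: real
  assumes "n \<ge> 2"
    and "levy_process M X"
    and "levy_symbol M X \<eta>"
    and "\<And>\<xi>. \<eta> \<xi> = Complex (\<eta>1 \<xi>) (\<eta>2 \<xi>)"
    and "\<eta> C2_differentiable_on (UNIV - {0})"
    and "0 < \<epsilon>" "\<epsilon> \<le> 1" "0 < \<alpha>" "0 < c"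
    and "\<And>\<xi>. \<eta>1 \<xi> \<ge> \<alpha> * slog n \<xi> powr \<epsilon>"
    and "\<And>\<xi>. \<bar>\<xi>\<bar> \<le> 1 \<Longrightarrow> \<bar>\<eta>2 \<xi>\<bar> \<le> c * \<bar>\<xi>\<bar> powr \<epsilon>"
    and "\<And>\<xi>. \<bar>\<xi>\<bar> \<ge> 1 \<Longrightarrow> \<bar>\<eta>2 \<xi>\<bar> \<le> c * (slog n \<xi> powr (\<epsilon> - 1) / rlog (n - 1) \<xi>)"
    and "\<And>f \<xi>. f \<in> {\<eta>1, \<eta>2} \<Longrightarrow> \<xi> \<noteq> 0 \<Longrightarrow> \<bar>\<xi>\<bar> \<le> 1 \<Longrightarrow>
           \<bar>deriv f \<xi>\<bar> \<le> c * \<bar>\<xi>\<bar> powr (\<epsilon> - 1)"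
    and "\<And>f \<xi>. f \<in> {\<eta>1, \<eta>2} \<Longrightarrow> \<bar>\<xi>\<bar> \<ge> 1 \<Longrightarrow>
           \<bar>deriv f \<xi>\<bar> \<le> c * (slog n \<xi> powr (\<epsilon> - 1) / rlog (n - 1) \<xi> / (1 + \<bar>\<xi>\<bar>))"
    and "\<And>f \<xi>. f \<in> {\<eta>1, \<eta>2} \<Longrightarrow> \<xi> \<noteq> 0 \<Longrightarrow> \<bar>\<xi>\<bar> \<le> 1 \<Longrightarrow>
           \<bar>deriv (deriv f) \<xi>\<bar> \<le> c * \<bar>\<xi>\<bar> powr (\<epsilon> - 2)"
    and "\<And>f \<xi>. f \<in> {\<eta>1, \<eta>2} \<Longrightarrow> \<bar>\<xi>\<bar> \<ge> 1 \<Longrightarrow>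
           \<bar>deriv (deriv f) \<xi>\<bar> \<le> c * (slog n \<xi> powr (\<epsilon> - 1) / rlog (n - 1) \<xi> / (1 + \<bar>\<xi>\<bar>)\<^sup>2)"
  shows "\<exists>(p :: real \<Rightarrow> real \<Rightarrow> real) (C :: real \<Rightarrow> real).
           transition_density M X p \<and>
           (\<forall>t>0. C t > 0) \<and>
           (\<exists>K>0. \<forall>t. 0 < t \<and> t \<le> 1 \<longrightarrow> C t \<le> K * t) \<and>
           (\<forall>t>0. \<forall>x. 0 < \<bar>x\<bar> \<and> \<bar>x\<bar> \<le> 1 \<longrightarrow>
              p t x \<le> C t * (1 / \<bar>x\<bar>) * exp (- (\<alpha> * t * slog n (1 / x) powr \<epsilon>)) *
                       slog n (1 / x) powr (\<epsilon> - 1) / rlog (n - 1) (1 / x)) \<and>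
           (\<forall>t>0. \<forall>x. \<bar>x\<bar> \<ge> 1 \<longrightarrow>
              p t x \<le> C t * (if \<epsilon> < 1 then \<bar>x\<bar> powr (- 1 - \<epsilon>)
                              else \<bar>x\<bar> powr (- 2) * ln (1 + \<bar>x\<bar>))) \<and>
           (set_integrable lborel {0<..<1} (\<lambda>\<xi>. \<bar>deriv (deriv \<eta>1) \<xi>\<bar>) \<and> \<epsilon> = 1 \<longrightarrow>
              (\<forall>t>0. \<forall>x. \<bar>x\<bar> \<ge> 1 \<longrightarrow> p t x \<le> C t * \<bar>x\<bar> powr (- 2)))"
proof -
  note n = assms(1) and eps = assms(6,7) and \<alpha> = assms(8) and c = assms(9)
  interpret levy_process M X by (rule assms(2))
  have Re_\<eta>: "\<eta>1 \<xi> = Re (\<eta> \<xi>)" and Im_\<eta>: "\<eta>2 \<xi> = Im (\<eta> \<xi>)" for \<xi> by (simp_all add: assms(4))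
  note d1 = C2_differentiable_on_component[OF assms(5) bounded_linear_Re Re_\<eta>]
    and d2 = C2_differentiable_on_component[OF assms(5) bounded_linear_Im Im_\<eta>]
  interpret S: log_symbol n \<epsilon> \<alpha> c \<eta>1 \<eta>2 "deriv \<eta>1" "deriv \<eta>2" "deriv (deriv \<eta>1)" "deriv (deriv \<eta>2)"
  proof
    fix \<xi> :: real
    show "2 \<le> n" "0 < \<epsilon>" "\<epsilon> \<le> 1" "0 < \<alpha>" "0 < c" by fact+
    show "\<alpha> * slog n \<xi> powr \<epsilon> \<le> \<eta>1 \<xi>" by (rule assms(10))
    show "\<bar>\<eta>2 \<xi>\<bar> \<le> c * \<xi> powr \<epsilon>" if "0 < \<xi>" "\<xi> \<le> 1" using assms(11)[of \<xi>] that by simp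
    show "\<bar>deriv \<eta>1 \<xi>\<bar> + \<bar>deriv \<eta>2 \<xi>\<bar> \<le> 2 * c * \<xi> powr (\<epsilon> - 1)" if "0 < \<xi>" "\<xi> \<le> 1"
      using assms(13)[of \<eta>1 \<xi>] assms(13)[of \<eta>2 \<xi>] that by simp
    show "\<bar>deriv \<eta>1 \<xi>\<bar> + \<bar>deriv \<eta>2 \<xi>\<bar> \<le> 2 * c * (log_weight n \<epsilon> \<xi> / (1 + \<xi>))" if "1 \<le> \<xi>"
      using assms(14)[of \<eta>1 \<xi>] assms(14)[of \<eta>2 \<xi>] that by (simp add: log_weight_def)
    show "\<bar>deriv (deriv \<eta>1) \<xi>\<bar> + \<bar>deriv (deriv \<eta>2) \<xi>\<bar> \<le> 2 * c * \<xi> powr (\<epsilon> - 2)" if "0 < \<xi>" "\<xi> \<le> 1"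
      using assms(15)[of \<eta>1 \<xi>] assms(15)[of \<eta>2 \<xi>] that by simp
    show "\<bar>deriv (deriv \<eta>1) \<xi>\<bar> + \<bar>deriv (deriv \<eta>2) \<xi>\<bar> \<le> 2 * c * (log_weight n \<epsilon> \<xi> / (1 + \<xi>)\<^sup>2)" if "1 \<le> \<xi>"
      using assms(16)[of \<eta>1 \<xi>] assms(16)[of \<eta>2 \<xi>] that by (simp add: log_weight_def)
    show "(\<eta>1 has_real_derivative deriv \<eta>1 \<xi>) (at \<xi>)" "(deriv \<eta>1 has_real_derivative deriv (deriv \<eta>1) \<xi>) (at \<xi>)"
      "(\<eta>2 has_real_derivative deriv \<eta>2 \<xi>) (at \<xi>)" "(deriv \<eta>2 has_real_derivative deriv (deriv \<eta>2) \<xi>) (at \<xi>)"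
      if "0 < \<xi>" using that by (auto intro: d1 d2)
    show "continuous_on {0<..} (deriv (deriv \<eta>1))" "continuous_on {0<..} (deriv (deriv \<eta>2))"
      by (auto intro: continuous_on_subset[OF d1(3)] continuous_on_subset[OF d2(3)])
  qed
  define Q where "Q \<longleftrightarrow> set_integrable lborel {0<..<1} (\<lambda>\<xi>. \<bar>deriv (deriv \<eta>1) \<xi>\<bar>)"
  have Q_int: "(\<lambda>\<xi>. \<bar>deriv (deriv \<eta>1) \<xi>\<bar>) integrable_on {0..1}" if Q
    using set_borel_integral_eq_integral(1)[OF that[unfolded Q_def]]
    by (simp only: integrable_on_open_interval_real)
  define P where "P \<tau> K \<longleftrightarrow> 0 < K \<and> (\<forall>t x T. 0 < t \<longrightarrow> t \<le> \<tau> \<longrightarrow> 0 < x \<longrightarrow> 1 \<le> T \<longrightarrow> 1 / x \<le> T \<longrightarrow>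
     continuous_on {0..T} (S.u t) \<longrightarrow>
     \<bar>integral {0..T} (\<lambda>\<xi>. cos (x * \<xi>) * S.u t \<xi>)\<bar>
       \<le> K * t * envelope n \<epsilon> Q (\<alpha> * t) x + (\<bar>S.u t T\<bar> / x + \<bar>S.u' t T\<bar> / x\<^sup>2))" for \<tau> K
  have "\<forall>\<tau>\<in>{0<..}. \<exists>K. P \<tau> K"
    unfolding P_def using S.cosine_transform_envelope[OF _ Q_int] by (intro ballI) simp
  then obtain K where PK: "\<forall>\<tau>\<in>{0<..}. P \<tau> (K \<tau>)" by (rule bchoice[THEN exE])
  have K: "0 < K \<tau>" if "0 < \<tau>" for \<tau> using PK that by (simp add: P_def)
  have K_bd: "\<bar>integral {0..T} (\<lambda>\<xi>. cos (x * \<xi>) * S.u t \<xi>)\<bar>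
       \<le> K \<tau> * t * envelope n \<epsilon> Q (\<alpha> * t) x + (\<bar>S.u t T\<bar> / x + \<bar>S.u' t T\<bar> / x\<^sup>2)"
    if "0 < \<tau>" "0 < t" "t \<le> \<tau>" "0 < x" "1 \<le> T" "1 / x \<le> T" "continuous_on {0..T} (S.u t)" for \<tau> t x T
  proof -
    have "P \<tau> (K \<tau>)" using PK that(1) by simp
    then show ?thesis unfolding P_def using that(2-) by blast
  qed
  \<comment> \<open>one constant for all \<open>t \<le> 1\<close>, which makes the final constant linear in \<open>t\<close> there\<close>
  define k where "k t = K (max 1 t) * t" for t
  have k_pos: "0 < k t" if "0 < t" for t using K[of "max 1 t"] that by (simp add: k_def)
  have dens: "\<exists>p. (\<forall>x. 0 \<le> p x) \<and> (\<forall>x. x \<noteq> 0 \<longrightarrow> p x \<le> k t * envelope n \<epsilon> Q (\<alpha> * t) \<bar>x\<bar>) \<and>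
      distributed M lborel (X t) (\<lambda>x. ennreal (p x))" if t: "0 < t" for t
  proof -
    have Xm: "X t \<in> borel_measurable M" using random_variable_X t by simp
    interpret N: real_distribution "distr M borel (X t)" by (rule real_distribution_distr[OF Xm])
    have ch: "char (distr M borel (X t)) \<xi> = exp (- (of_real t * \<eta> \<xi>))" for \<xi>
      using assms(3) t by (simp add: levy_symbol_def)
    have Re_ch: "Re (char (distr M borel (X t)) \<xi>) = S.u t \<xi>" for \<xi>
      unfolding ch S.u_def by (simp add: Re_exp assms(4))
    have norm_ch: "cmod (char (distr M borel (X t)) \<xi>) \<le> exp (- (\<alpha> * t * slog n \<xi> powr \<epsilon>))" for \<xi>
    proof -
      have "t * (\<alpha> * slog n \<xi> powr \<epsilon>) \<le> t * \<eta>1 \<xi>"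
        using assms(10) t by (intro mult_left_mono) auto
      then show ?thesis unfolding ch by (simp add: norm_exp_eq_Re assms(4) mult_ac)
    qed
    have u_cont: "continuous_on A (S.u t)" for A
    proof -
      have "continuous_on A (\<lambda>\<xi>. Re (char (distr M borel (X t)) \<xi>))"
        by (intro continuous_intros continuous_at_imp_continuous_on ballI N.isCont_char)
      then show ?thesis by (simp add: Re_ch)
    qed
    obtain p where p: "p \<in> borel_measurable borel" "\<And>x. 0 \<le> p x"
      "\<And>x. x \<noteq> 0 \<Longrightarrow> p x \<le> k t * envelope n \<epsilon> Q (\<alpha> * t) \<bar>x\<bar>"
      "distr M borel (X t) = density lborel (\<lambda>x. ennreal (p x))"
    proof (rule N.density_of_cosine_transform_bound)
      show "\<exists>L>0. \<forall>\<xi>. L \<le> \<bar>\<xi>\<bar> \<longrightarrow> cmod (char (distr M borel (X t)) \<xi>) \<le> \<delta>" if \<delta>: "0 < \<delta>" for \<delta>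
      proof -
        have "0 < \<alpha> * t" using \<alpha> t by simp
        then have "eventually (\<lambda>\<xi>. exp (- (\<alpha> * t * slog n \<xi> powr \<epsilon>)) < \<delta>) at_top"
          using order_tendstoD(2)[OF damping_tendsto \<delta>] eps by blast
        then obtain L where L: "\<And>\<xi>. L \<le> \<xi> \<Longrightarrow> exp (- (\<alpha> * t * slog n \<xi> powr \<epsilon>)) < \<delta>"
          by (auto simp: eventually_at_top_linorder)
        have "cmod (char (distr M borel (X t)) \<xi>) \<le> \<delta>" if "max 1 L \<le> \<bar>\<xi>\<bar>" for \<xi>
          using norm_ch[of \<xi>] L[of "\<bar>\<xi>\<bar>"] that by (simp add: slog_abs)
        then show ?thesis by (intro exI[of _ "max 1 L"]) auto
      qed
      show "continuous_on {0<..} (\<lambda>x. k t * envelope n \<epsilon> Q (\<alpha> * t) x)"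
        by (intro continuous_intros continuous_on_envelope)
      show "0 \<le> k t * envelope n \<epsilon> Q (\<alpha> * t) x" if "0 < x" for x
        using k_pos[OF t] envelope_nonneg[OF that] by simp
      show "\<exists>e. (e \<longlongrightarrow> 0) at_top \<and> eventually (\<lambda>T. \<forall>x\<in>{l..r}.
          \<bar>integral {0..T} (\<lambda>\<xi>. cos (x * \<xi>) * Re (char (distr M borel (X t)) \<xi>))\<bar>
            \<le> k t * envelope n \<epsilon> Q (\<alpha> * t) x + e T) at_top" if l: "0 < l" for l r
      proof (intro exI conjI)
        let ?e = "\<lambda>T. \<bar>S.u t T\<bar> / l + \<bar>S.u' t T\<bar> / l\<^sup>2"
        have "(?e \<longlongrightarrow> \<bar>0\<bar> / l + \<bar>0\<bar> / l\<^sup>2) at_top"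
          using l by (intro tendsto_intros S.u_tendsto[OF t] S.u'_tendsto[OF t]) auto
        then show "(?e \<longlongrightarrow> 0) at_top" by simp
        show "eventually (\<lambda>T. \<forall>x\<in>{l..r}.
            \<bar>integral {0..T} (\<lambda>\<xi>. cos (x * \<xi>) * Re (char (distr M borel (X t)) \<xi>))\<bar>
              \<le> k t * envelope n \<epsilon> Q (\<alpha> * t) x + ?e T) at_top"
          using eventually_ge_at_top[of "max 1 (1 / l)"]
        proof eventually_elim
          case (elim T)
          show ?case
          proof
            fix x assume x: "x \<in> {l..r}"
            then have x0: "0 < x" and lx: "l \<le> x" using l by auto
            have "1 / x \<le> 1 / l" using l lx by (simp add: frac_le)
            then have T: "1 \<le> T" "1 / x \<le> T" using elim by auto
            have "\<bar>integral {0..T} (\<lambda>\<xi>. cos (x * \<xi>) * S.u t \<xi>)\<bar>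
                \<le> k t * envelope n \<epsilon> Q (\<alpha> * t) x + (\<bar>S.u t T\<bar> / x + \<bar>S.u' t T\<bar> / x\<^sup>2)"
              unfolding k_def by (rule K_bd) (use t x0 T u_cont in auto)
            also have "\<bar>S.u t T\<bar> / x + \<bar>S.u' t T\<bar> / x\<^sup>2 \<le> ?e T"
              using l lx by (intro add_mono divide_left_mono power_mono) auto
            finally show "\<bar>integral {0..T} (\<lambda>\<xi>. cos (x * \<xi>) * Re (char (distr M borel (X t)) \<xi>))\<bar>
                \<le> k t * envelope n \<epsilon> Q (\<alpha> * t) x + ?e T"
              by (simp add: Re_ch)
          qed
        qed
      qed
    qed (rule that; assumption)
    have "distr M lborel (X t) = distr M borel (X t)" by (rule distr_cong) auto
    then have "distributed M lborel (X t) (\<lambda>x. ennreal (p x))"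
      unfolding distributed_def using p(1,4) Xm by simp
    then show ?thesis using p(2,3) by blast
  qed
  then have "\<forall>t\<in>{0<..}. \<exists>p. (\<forall>x. 0 \<le> p x) \<and> (\<forall>x. x \<noteq> 0 \<longrightarrow> p x \<le> k t * envelope n \<epsilon> Q (\<alpha> * t) \<bar>x\<bar>) \<and>
      distributed M lborel (X t) (\<lambda>x. ennreal (p x))"
    by (intro ballI) simp
  then obtain p where p_all: "\<forall>t\<in>{0<..}. (\<forall>x. 0 \<le> p t x) \<and> (\<forall>x. x \<noteq> 0 \<longrightarrow> p t x \<le> k t * envelope n \<epsilon> Q (\<alpha> * t) \<bar>x\<bar>) \<and>
      distributed M lborel (X t) (\<lambda>x. ennreal (p t x))"
    by (rule bchoice[THEN exE])
  have p: "0 \<le> p t x" and p_le: "x \<noteq> 0 \<Longrightarrow> p t x \<le> k t * envelope n \<epsilon> Q (\<alpha> * t) \<bar>x\<bar>"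
    and p_dens: "distributed M lborel (X t) (\<lambda>x. ennreal (p t x))" if "0 < t" for t x
    using bspec[OF p_all, of t] that by auto
  define m where "m = 1 + 2 * log_weight n \<epsilon> 1"
  have m: "1 \<le> m" using S.log_weight_1_pos by (simp add: m_def)
  define C where "C t = k t * m" for t
  show ?thesis
  proof (intro exI conjI allI impI)
    show "transition_density M X p" unfolding transition_density_def using p p_dens by blast
    show "0 < C t" if "0 < t" for t using k_pos[OF that] m by (simp add: C_def)
    show "0 < K 1 * m" using K[of 1] m by simp
    show "C t \<le> K 1 * m * t" if "0 < t \<and> t \<le> 1" for t
    proof -
      have "max 1 t = 1" using that by simp
      then show ?thesis by (simp add: C_def k_def mult_ac)
    qed
  next
    fix t x :: real assume t: "0 < t" and x: "0 < \<bar>x\<bar> \<and> \<bar>x\<bar> \<le> 1"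
    have W: "0 < damped_weight n \<epsilon> (\<alpha> * t) (1 / \<bar>x\<bar>)" using x by (intro damped_weight_pos) auto
    have "p t x \<le> k t * envelope n \<epsilon> Q (\<alpha> * t) \<bar>x\<bar>" using p_le[OF t] x by simp
    also have "\<dots> \<le> k t * (1 / \<bar>x\<bar> * damped_weight n \<epsilon> (\<alpha> * t) (1 / \<bar>x\<bar>))"
      using k_pos[OF t] x by (intro mult_left_mono envelope_le_small) auto
    also have "\<dots> \<le> C t * (1 / \<bar>x\<bar> * damped_weight n \<epsilon> (\<alpha> * t) (1 / \<bar>x\<bar>))"
      unfolding C_def using k_pos[OF t] m W x by (intro mult_right_mono) auto
    also have "damped_weight n \<epsilon> (\<alpha> * t) (1 / \<bar>x\<bar>) = damped_weight n \<epsilon> (\<alpha> * t) (1 / x)"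
      using slog_abs[of n "1 / x"] rlog_abs[of "n - 1" "1 / x"]
      by (simp add: damped_weight_def log_weight_def)
    finally show "p t x \<le> C t * (1 / \<bar>x\<bar>) * exp (- (\<alpha> * t * slog n (1 / x) powr \<epsilon>)) *
                       slog n (1 / x) powr (\<epsilon> - 1) / rlog (n - 1) (1 / x)"
      by (simp add: damped_weight_def log_weight_def)
  next
    fix t x :: real assume t: "0 < t" and x: "1 \<le> \<bar>x\<bar>"
    have "p t x \<le> k t * envelope n \<epsilon> Q (\<alpha> * t) \<bar>x\<bar>" using p_le[OF t] x by fastforce
    also have "\<dots> \<le> k t * (log_weight n \<epsilon> 1 * tail_decay \<epsilon> Q \<bar>x\<bar>)"
      using k_pos[OF t] x t \<alpha> by (intro mult_left_mono envelope_le_large) auto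
    finally have le: "p t x \<le> k t * log_weight n \<epsilon> 1 * tail_decay \<epsilon> Q \<bar>x\<bar>" by (simp add: mult.assoc)
    have kw: "0 \<le> k t * log_weight n \<epsilon> 1" "k t * log_weight n \<epsilon> 1 * 2 \<le> C t"
      using k_pos[OF t] S.log_weight_1_pos by (auto simp: C_def m_def algebra_simps)
    let ?d = "if \<epsilon> < 1 then \<bar>x\<bar> powr (- 1 - \<epsilon>) else \<bar>x\<bar> powr (- 2) * ln (1 + \<bar>x\<bar>)"
    have d: "0 \<le> ?d" using x by simp
    have "p t x \<le> k t * log_weight n \<epsilon> 1 * (2 * ?d)"
      by (rule order_trans[OF le mult_left_mono[OF tail_decay_le[OF x eps(2)] kw(1)]])
    also have "\<dots> \<le> C t * ?d" using mult_right_mono[OF kw(2) d] by (simp only: mult.assoc)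
    finally show "p t x \<le> C t * ?d" .
    assume "set_integrable lborel {0<..<1} (\<lambda>\<xi>. \<bar>deriv (deriv \<eta>1) \<xi>\<bar>) \<and> \<epsilon> = 1"
    then have "tail_decay \<epsilon> Q \<bar>x\<bar> = \<bar>x\<bar> powr (- 2)" by (simp add: tail_decay_def Q_def)
    moreover have "k t * log_weight n \<epsilon> 1 \<le> C t" using kw by linarith
    ultimately show "p t x \<le> C t * \<bar>x\<bar> powr (- 2)"
      using le by (auto intro: order_trans[OF _ mult_right_mono])
  qed
qed

end
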